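(* Let $n\ge1$ and let $m$ be a positive integer. Let $\eta=(\eta_1,\dots,\eta_n)$ be integers with $m>\eta_1>\dots>\eta_n\ge0$, and let $\lambda=(\lambda_1,\dots,\lambda_n)$ be integers with $m>\lambda_{s+1}>\dots>\lambda_n>\lambda_1>\dots>\lambda_s\ge0$ for some $s$. Then, as $k\to\infty$ such that $k\equiv|\lambda|-|\eta|+Nnm+sm\pmod 2$ for some integer $N$, the number of walks on the $m$-circle from $\eta$ to $\lambda$ with exactly $k$ standard steps, such that at no time two coordinates of a point of the walk are equal, is asymptotically $$\frac{2^{n^2-n+1}}{nm^n}\left(2\frac{\sin\frac{n\pi}{m}}{\sin\frac{\pi}{m}}\right)^k\prod_{1\le h<t\le n}\left(\sin\frac{\pi(\eta_h-\eta_t)}{m}\cdot\left|\sin\frac{\pi(\lambda_h-\lambda_t)}{m}\right|\right)$$ if $n$ is even, or if $n$ is odd and $m$ is even; and it is asymptotically $$\frac{2^{n^2-n}}{nm^n}\left(2\frac{\sin\frac{n\pi}{m}}{\sin\frac{\pi}{m}}\right)^k\prod_{1\le h<t\le n}\left(\sin\frac{\pi(\eta_h-\eta_t)}{m}\cdot\left|\sin\frac{\pi(\lambda_h-\lambda_t)}{m}\right|\right)$$ if both $n$ and $m$ are odd.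
   Context: For $\eta\in\mathbb R^n$, $|\eta|=\eta_1+\dots+\eta_n$. Walks on the $m$-circle are walks in $n$-space where each coordinate is taken modulo $m$ (points $(x_1,\dots,x_n)$ and $(x_1+k_1m,\dots,x_n+k_nm)$, $k_j\in\mathbb Z$, are identified). A walk with $k$ standard steps from $\eta$ to $\lambda$ is a sequence $p_0=\eta,\dots,p_k=\lambda$ of such points with $p_i-p_{i-1}\in\{\pm e_1,\dots,\pm e_n\}$ ($e_j$ standard unit vectors); the condition is that for every $i$ and $h\ne t$, the $h$-th and $t$-th coordinates of $p_i$ are distinct modulo $m$. "Asymptotically $E$" means the ratio of the count to $E$ tends to $1$. *)

theory Defs
  imports
    Complex_Main
    "HOL-Library.Landau_Symbols"
    "HOL-Number_Theory.Cong"
    "Jordan_Normal_Form.Matrix"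
begin

text \<open>
  Points of n-space are integer vectors of dimension \<open>n\<close>; coordinates are indexed
  \<open>0, \<dots>, n - 1\<close>.
\<close>

definition vec_total :: "int vec \<Rightarrow> int" where
  "vec_total v = (\<Sum>i<dim_vec v. v $ i)"

definition standard_steps :: "nat \<Rightarrow> int vec set" where
  "standard_steps n = {unit_vec n j |j. j < n} \<union> {- unit_vec n j |j. j < n}"

text \<open>
  The same point of the \<open>m\<close>-circle: coordinates are identified modulo \<open>m\<close>, independently
  of each other.
\<close>

definition same_circle_point :: "nat \<Rightarrow> int vec \<Rightarrow> int vec \<Rightarrow> bool" where
  "same_circle_point m u v \<longleftrightarrow>
     dim_vec u = dim_vec v \<and> (\<forall>i<dim_vec u. [u $ i = v $ i] (mod int m))"

text \<open>
  A walk on the \<open>m\<close>-circle is represented by its unique lift to n-space that starts at the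
  vector \<open>a\<close> itself; its end point is prescribed only as a point of the \<open>m\<close>-circle.  For
  \<open>m \<ge> 3\<close> this is the same as recording the sequence of residue vectors.  For \<open>m \<le> 2\<close> the steps
  \<open>e\<^sub>j\<close> and \<open>- e\<^sub>j\<close> lead to the same point of the circle but still count as different steps
  (for \<open>n = 1\<close> and \<open>m = 2\<close> there are \<open>2 ^ k\<close> walks with \<open>k\<close> steps to the point of the right
  parity).
\<close>

definition circle_walks ::
    "nat \<Rightarrow> nat \<Rightarrow> int vec \<Rightarrow> int vec \<Rightarrow> nat \<Rightarrow> int vec list set" where
  "circle_walks n m a b k =
     {p. length p = Suc k \<and> set p \<subseteq> carrier_vec n \<and>
         p ! 0 = a \<and> same_circle_point m (p ! k) b \<and>
         (\<forall>i<k. p ! Suc i - p ! i \<in> standard_steps n)}"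

definition noncolliding_circle_walks ::
    "nat \<Rightarrow> nat \<Rightarrow> int vec \<Rightarrow> int vec \<Rightarrow> nat \<Rightarrow> int vec list set" where
  "noncolliding_circle_walks n m a b k =
     {p \<in> circle_walks n m a b k.
        \<forall>i\<le>k. \<forall>h<n. \<forall>t<n. h \<noteq> t \<longrightarrow> \<not> [p ! i $ h = p ! i $ t] (mod int m)}"

text \<open>
  The quotient of sines in the growth rate.  For \<open>m = 1\<close> both sines vanish; noncolliding
  walks then exist only for \<open>n = 1\<close>, where the quotient of the two identical sines is read as \<open>1\<close>
  (division by zero would give \<open>0\<close>).
\<close>

definition sine_quotient :: "nat \<Rightarrow> nat \<Rightarrow> real" where
  "sine_quotient n m =
     (if m = 1 then 1 else sin (real n * pi / real m) / sin (pi / real m))"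

definition sine_product :: "nat \<Rightarrow> nat \<Rightarrow> int vec \<Rightarrow> int vec \<Rightarrow> real" where
  "sine_product n m a b =
     (\<Prod>(h, t) \<in> {(h, t). h < t \<and> t < n}.
        sin (pi * of_int (a $ h - a $ t) / real m) *
        \<bar>sin (pi * of_int (b $ h - b $ t) / real m)\<bar>)"

end

theory Submission
  imports Defs "Jordan_Normal_Form.Determinant" "HOL-Combinatorics.Multiset_Permutations"
begin

text \<open>
  Lifted to n-space, a noncolliding walk stays in the alcove
  \<open>p\<^sub>1 > \<dots> > p\<^sub>n > p\<^sub>1 - m\<close>. On the alcove the product of sines
  \<open>V p = (\<Prod>h<t. sin (\<pi> (p\<^sub>h - p\<^sub>t) / m))\<close> is positive, it vanishes at collisions, and as a
  Slater determinant of characters it is an eigenfunction of the step operator with eigenvalue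
  \<open>\<rho> = 2 sin (n \<pi> / m) / sin (\<pi> / m)\<close>. Dividing the number of \<open>k\<close>-step walks from \<open>p\<close> by
  \<open>\<rho>\<^sup>k V p\<close> therefore turns the recursion in \<open>k\<close> into repeated averaging (Doob transform).
  If \<open>n < m\<close> or \<open>n = 1\<close>, any two points of equal parity are joined, up to a translation by a
  multiple of \<open>m\<close>, by a path of a fixed length, so the averages converge to a constant on each
  parity class. As the step operator is symmetric, the sum of the numbers of walks weighted by
  \<open>V\<close> is exactly \<open>\<rho>\<^sup>k V l\<close>; comparing it with the sum of \<open>V\<^sup>2\<close>, which orthogonality of characters
  evaluates, identifies the constant. If \<open>n m\<close> is even, one of the two parity classes carries no
  walks, which accounts for the additional factor \<open>2\<close>. If \<open>n = m > 1\<close>, then \<open>\<rho> = 0\<close> and there are no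
  walks with \<open>k > 0\<close>.
\<close>

subsection \<open>Determinants and trigonometric sums\<close>

text \<open>The obstacle is that \<open>V\<close> is not a function on the circle: moving one
  coordinate by \<open>m\<close> multiplies it by \<open>(-1) ^ (n - 1)\<close>, and a walk keeps
  only the cyclic order of its coordinates. So signs and positivity are handled on the alcove, while
  sums run over one representative of each circle point and use \<open>\<bar>V\<bar>\<close>, whose
  eigenvalue equation is applied only where walks exist. The alcove is infinite, but
  \<open>V\<close> and the numbers of walks are unchanged there when all coordinates move by
  \<open>m\<close> together, hence take finitely many values. This translation changes the
  coordinate sum by \<open>n * m\<close>. If that is odd, it exchanges the parity classes and forces
  their limits to agree; if it is even, the end point fixes the class of all its walks. In both
  cases the two limits add up to \<open>2 * V l / Z\<close>, where \<open>Z\<close> is the sum of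
  \<open>V\<^sup>2\<close> over alcove points modulo the translation. Of the \<open>n!\<close>
  orderings of \<open>n\<close> occupied sites only the \<open>n\<close> rotations of the decreasing
  one lift to the alcove, whence \<open>Z = n * m ^ n / 2 ^ (n\<^sup>2 - n)\<close>.\<close>

lemma det_vandermonde:
  fixes z :: "nat \<Rightarrow> 'a::field"
  shows "det (mat n n (\<lambda>(i, j). z i ^ j)) = (\<Prod>t<n. \<Prod>h<t. z t - z h)"
proof (induction n)
  case 0
  show ?case by (simp add: det_def)
next
  case (Suc n)
  \<comment> \<open>The last node becomes a variable \<open>x\<close>. Expansion along the last row
    gives a polynomial of degree at most \<open>n\<close> in \<open>x\<close> whose top coefficient
    is the smaller Vandermonde determinant and which vanishes at the other nodes.\<close>
  define M where "M x = mat (Suc n) (Suc n) (\<lambda>(i, j). (z(n := x)) i ^ j)" for x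
  have M: "M x \<in> carrier_mat (Suc n) (Suc n)" for x by (simp add: M_def)
  define c where "c j = cofactor (M (z n)) n j" for j
  have cofactor_M: "cofactor (M x) n j = c j" if "j \<le> n" for x j
  proof -
    have "mat_delete (M x) n j = mat_delete (M (z n)) n j"
      using that by (intro eq_matI) (auto simp: mat_delete_def M_def)
    then show ?thesis by (simp add: c_def cofactor_def)
  qed
  define P where "P = (\<Sum>j\<le>n. monom (c j) j)"
  have det_M: "det (M x) = poly P x" for x
  proof -
    have "det (M x) = (\<Sum>j<Suc n. M x $$ (n, j) * cofactor (M x) n j)"
      by (rule laplace_expansion_row[OF M]) simp
    also have "\<dots> = (\<Sum>j<Suc n. x ^ j * c j)"
      by (intro sum.cong refl arg_cong2[of _ _ _ _ times]) (simp_all add: cofactor_M, simp add: M_def)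
    also have "\<dots> = poly P x"
      by (simp add: P_def poly_sum poly_monom mult.commute lessThan_Suc_atMost)
    finally show ?thesis .
  qed
  have "mat_delete (M (z n)) n n = mat n n (\<lambda>(i, j). z i ^ j)"
    by (intro eq_matI) (auto simp: mat_delete_def M_def)
  then have c_n: "c n = (\<Prod>t<n. \<Prod>h<t. z t - z h)"
    by (simp add: c_def cofactor_def Suc)
  \<comment> \<open>Counting roots needs \<open>n\<close> different nodes; if two of them coincide,
    both sides vanish because two rows are equal.\<close>
  have "poly P x = c n * (\<Prod>h<n. x - z h)" for x
  proof (cases "inj_on z {..<n}")
    case True
    have root: "poly P (z h) = 0" if "h < n" for h
      unfolding det_M[symmetric]
      by (rule det_identical_rows[OF M, of h n]) (use that in \<open>auto simp: M_def intro!: eq_vecI\<close>)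
    define R where "R = smult (c n) (\<Prod>h<n. [:- z h, 1:])"
    have deg_prod: "degree (\<Prod>h<n. [:- z h, 1:]) = n"
      by (subst degree_prod_eq_sum_degree) auto
    have lead_prod: "lead_coeff (\<Prod>h<n. [:- z h, 1:]) = 1"
      by (simp add: lead_coeff_prod)
    have coeff_P: "coeff P n = c n"
      by (simp add: P_def coeff_sum)
    have deg_P: "degree P \<le> n" unfolding P_def
      by (intro degree_sum_le) (auto intro: order.trans[OF degree_monom_le])
    have "P - R = 0"
    proof (rule ccontr)
      assume nz: "P - R \<noteq> 0"
      have "coeff (P - R) n = 0"
        using lead_prod deg_prod by (simp add: coeff_P R_def)
      moreover have "degree (P - R) \<le> n"
        using deg_P deg_prod by (intro degree_diff_le) (auto simp: R_def)
      ultimately have "degree (P - R) < n \<or> n = 0 \<and> P - R = 0"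
        by (metis le_eq_less_or_eq leading_coeff_0_iff not_less_zero nz)
      then have deg: "degree (P - R) < n" using nz by simp
      have "z ` {..<n} \<subseteq> {x. poly (P - R) x = 0}"
        by (auto simp: root R_def poly_prod)
      then have "card (z ` {..<n}) \<le> card {x. poly (P - R) x = 0}"
        by (intro card_mono poly_roots_finite nz)
      also have "\<dots> \<le> degree (P - R)"
        by (rule card_poly_roots_bound[OF nz])
      finally show False using deg by (simp add: card_image[OF True])
    qed
    then have "P = R" by simp
    then show ?thesis by (simp add: R_def poly_prod)
  next
    case False
    then obtain a b where ab: "a < n" "b < n" "a \<noteq> b" "z a = z b"
      by (auto simp: inj_on_def)
    have "det (M x) = 0"
      by (rule det_identical_rows[OF M, of a b]) (use ab in \<open>auto simp: M_def intro!: eq_vecI\<close>)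
    moreover have "det (mat n n (\<lambda>(i, j). z i ^ j)) = 0"
      by (rule det_identical_rows[of _ n a b]) (use ab in \<open>auto intro!: eq_vecI\<close>)
    ultimately show ?thesis by (simp add: det_M[symmetric] c_n Suc[symmetric])
  qed
  then have "det (M (z n)) = (\<Prod>t<Suc n. \<Prod>h<t. z t - z h)"
    by (simp add: det_M c_n)
  then show ?case by (simp add: M_def)
qed

lemma vandermonde_permutation_sum:
  fixes z :: "nat \<Rightarrow> 'a::field"
  shows "(\<Sum>\<sigma> | \<sigma> permutes {..<n}. signof \<sigma> * (\<Prod>h<n. z h ^ \<sigma> h)) = (\<Prod>t<n. \<Prod>h<t. z t - z h)"
proof -
  have "det (mat n n (\<lambda>(i, j). z i ^ j)) =
      (\<Sum>\<sigma> | \<sigma> permutes {..<n}. signof \<sigma> * (\<Prod>h<n. z h ^ \<sigma> h))"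
    by (subst det_def')
      (auto simp: atLeast0LessThan permutes_in_image intro!: sum.cong prod.cong)
  then show ?thesis by (simp add: det_vandermonde)
qed

lemma prod_pairs_less:
  fixes f :: "nat \<Rightarrow> nat \<Rightarrow> 'a::comm_monoid_mult"
  shows "(\<Prod>(h, t) \<in> {(h, t). h < t \<and> t < n}. f h t) = (\<Prod>t<n. \<Prod>h<t. f h t)"
proof -
  have "(\<Prod>t<n. \<Prod>h<t. f h t) = (\<Prod>(t, h) \<in> Sigma {..<n} (\<lambda>t. {..<t}). f h t)"
    by (rule prod.Sigma) auto
  also have "\<dots> = (\<Prod>(h, t) \<in> {(h, t). h < t \<and> t < n}. f h t)"
    by (rule prod.reindex_bij_witness[of _ "\<lambda>(h, t). (t, h)" "\<lambda>(t, h). (h, t)"]) auto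
  finally show ?thesis by simp
qed

lemma prod_pairs_symmetric:
  fixes g :: "nat \<Rightarrow> 'a::comm_monoid_mult"
  shows "(\<Prod>t<n. \<Prod>h<t. g t * g h) = (\<Prod>h<n. g h) ^ (n - 1)"
proof (induction n)
  case (Suc n)
  let ?G = "\<Prod>h<n. g h"
  have "(\<Prod>t<Suc n. \<Prod>h<t. g t * g h) = ?G ^ (n - 1) * (g n ^ n * ?G)"
    by (simp only: prod.lessThan_Suc Suc) (simp add: prod.distrib)
  also have "\<dots> = (?G * g n) ^ n"
    by (cases n) (simp_all add: power_mult_distrib mult_ac)
  finally show ?case by simp
qed simp

text \<open>Squaring avoids halving \<open>n\<^sup>2 - n\<close>, twice the number of pairs. With
  \<open>c = 2\<close> this yields the power of two in the final constant.\<close>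

lemma prod_const_pairs: "(\<Prod>t<n. \<Prod>h<t. c) ^ 2 = (c :: 'a::comm_monoid_mult) ^ (n\<^sup>2 - n)"
proof (induction n)
  case (Suc n)
  have "2 * n + (n\<^sup>2 - n) = (Suc n)\<^sup>2 - Suc n"
    using le_square[of n] by (simp add: power2_eq_square)
  moreover have "(\<Prod>t<Suc n. \<Prod>h<t. c) ^ 2 = c ^ (2 * n) * c ^ (n\<^sup>2 - n)"
    by (simp add: power_mult_distrib Suc[simplified] power_mult[symmetric] mult.commute)
  ultimately show ?case by (simp add: power_add[symmetric])
qed simp

text \<open>Twisting the Vandermonde determinant by the phase \<open>cis (- (n - 1) (\<theta>\<^sub>1 + \<dots> + \<theta>\<^sub>n))\<close> makes
  it a real multiple of the product of sines.\<close>

lemma slater_eq_prod_sin: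
  fixes \<theta> :: "nat \<Rightarrow> real"
  shows "(\<Sum>\<sigma> | \<sigma> permutes {..<n}. signof \<sigma> * (\<Prod>h<n. cis ((2 * real (\<sigma> h) - (real n - 1)) * \<theta> h))) =
    (\<Prod>t<n. \<Prod>h<t. 2 * \<i> * sin (\<theta> t - \<theta> h))"
proof -
  define E where "E = (\<Prod>h<n. cis (\<theta> h)) ^ (n - 1)"
  have "cmod E = 1" by (simp add: E_def norm_power prod_norm[symmetric])
  then have E0: "E \<noteq> 0" by auto
  have "E * (\<Sum>\<sigma> | \<sigma> permutes {..<n}. signof \<sigma> * (\<Prod>h<n. cis ((2 * real (\<sigma> h) - (real n - 1)) * \<theta> h)))
    = (\<Sum>\<sigma> | \<sigma> permutes {..<n}. signof \<sigma> * (\<Prod>h<n. (cis (2 * \<theta> h)) ^ \<sigma> h))"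
    unfolding sum_distrib_left
  proof (intro sum.cong refl)
    fix \<sigma>
    have "E * (\<Prod>h<n. cis ((2 * real (\<sigma> h) - (real n - 1)) * \<theta> h)) = (\<Prod>h<n. (cis (2 * \<theta> h)) ^ \<sigma> h)"
      unfolding E_def prod_power_distrib prod.distrib[symmetric]
    proof (intro prod.cong refl)
      fix h assume "h \<in> {..<n}"
      then have "real (n - 1) = real n - 1" by auto
      then show "cis (\<theta> h) ^ (n - 1) * cis ((2 * real (\<sigma> h) - (real n - 1)) * \<theta> h) = cis (2 * \<theta> h) ^ \<sigma> h"
        by (simp add: DeMoivre cis_mult algebra_simps)
    qed
    then show "E * (signof \<sigma> * (\<Prod>h<n. cis ((2 * real (\<sigma> h) - (real n - 1)) * \<theta> h))) =
       signof \<sigma> * (\<Prod>h<n. (cis (2 * \<theta> h)) ^ \<sigma> h)"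
      by (simp add: mult.left_commute)
  qed
  also have "\<dots> = (\<Prod>t<n. \<Prod>h<t. cis (2 * \<theta> t) - cis (2 * \<theta> h))"
    by (rule vandermonde_permutation_sum)
  also have "\<dots> = (\<Prod>t<n. \<Prod>h<t. (cis (\<theta> t) * cis (\<theta> h)) * (2 * \<i> * sin (\<theta> t - \<theta> h)))"
  proof (intro prod.cong refl)
    fix t h
    have "2 * \<i> * sin (\<theta> t - \<theta> h) = cis (\<theta> t - \<theta> h) - cis (- (\<theta> t - \<theta> h))"
      by (simp add: complex_eq_iff del: minus_diff_eq)
    then have "(cis (\<theta> t) * cis (\<theta> h)) * (2 * \<i> * sin (\<theta> t - \<theta> h)) =
        cis (\<theta> t + \<theta> h) * (cis (\<theta> t - \<theta> h) - cis (- (\<theta> t - \<theta> h)))"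
      by (simp add: cis_mult)
    also have "\<dots> = cis (2 * \<theta> t) - cis (2 * \<theta> h)"
      unfolding right_diff_distrib cis_mult by (simp add: algebra_simps)
    finally show "cis (2 * \<theta> t) - cis (2 * \<theta> h) = (cis (\<theta> t) * cis (\<theta> h)) * (2 * \<i> * sin (\<theta> t - \<theta> h))"
      by simp
  qed
  also have "\<dots> = E * (\<Prod>t<n. \<Prod>h<t. 2 * \<i> * sin (\<theta> t - \<theta> h))"
    unfolding prod.distrib[of "\<lambda>h. cis (\<theta> t) * cis (\<theta> h)" for t] E_def
    by (subst prod.distrib, subst prod_pairs_symmetric) (rule refl)
  finally show ?thesis using E0 by simp
qed

text \<open>A geometric sum: the terms are powers of an \<open>m\<close>-th root of unity, and the
  bound on \<open>j\<close> leaves \<open>j = 0\<close> as the only case in which this root is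
  \<open>1\<close>.\<close>

lemma sum_cis_root_of_unity:
  fixes j :: int and m :: nat
  assumes "m > 0" "\<bar>j\<bar> < int m"
  shows "(\<Sum>y<m. cis (2 * pi * of_int j * real y / real m)) = (if j = 0 then of_nat m else 0)"
proof (cases "j = 0")
  case False
  define w where "w = cis (2 * pi * of_int j / real m)"
  have w_power: "cis (2 * pi * of_int j * real y / real m) = w ^ y" for y
    by (simp add: w_def DeMoivre mult_ac)
  have "w \<noteq> 1"
  proof
    assume "w = 1"
    then have "cos (2 * pi * of_int j / real m) = 1" by (simp add: w_def complex_eq_iff)
    then obtain x :: int where "2 * pi * of_int j / real m = of_int x * 2 * pi"
      unfolding cos_one_2pi_int by auto
    then have "real_of_int j = real_of_int (x * int m)"
      using assms by (simp add: field_simps)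
    then have "j = x * int m" by linarith
    then have "int m dvd j" by simp
    then show False using assms False by (auto dest: dvd_imp_le_int)
  qed
  moreover have "w ^ m = 1"
    using assms by (simp add: w_def DeMoivre cis_multiple_2pi)
  ultimately show ?thesis using False
    unfolding w_power by (subst sum_gp_strict) simp
qed simp

text \<open>The frequencies are centred at zero, so multiplication by \<open>sin (pi / m)\<close>
  makes the sum telescope, as for the Dirichlet kernel. At \<open>m = 1\<close> that factor
  vanishes, and the conventional value of \<open>sine_quotient\<close> fits the case
  \<open>n = 1\<close>.\<close>

lemma sum_cos_arithmetic:
  assumes "m \<ge> 2 \<or> m = 1 \<and> n = 1"
  shows "(\<Sum>j<n. 2 * cos (pi * (2 * real j - (real n - 1)) / real m)) = 2 * sine_quotient n m"
proof (cases "m = 1")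
  case True
  then show ?thesis using assms by (auto simp: sine_quotient_def)
next
  case False
  then have m: "m \<ge> 2" using assms by simp
  then have "pi / m < pi" "pi / m > 0" by (auto simp: field_simps)
  then have s: "sin (pi / m) > 0" by (intro sin_gt_zero) auto
  have telescope: "sin (pi / m) * (2 * cos (pi * (2 * real j - (real n - 1)) / m)) =
     sin (pi * (2 * real (Suc j) - real n) / m) - sin (pi * (2 * real j - real n) / m)" for j
  proof -
    define a where "a = pi * (2 * real j - (real n - 1)) / m"
    have "pi * (2 * real (Suc j) - real n) / m = a + pi / m"
      "pi * (2 * real j - real n) / m = a - pi / m"
      using m by (auto simp: a_def field_simps)
    then show ?thesis by (simp only: a_def[symmetric] sin_add sin_diff) simp
  qed
  have "sin (pi / m) * (\<Sum>j<n. 2 * cos (pi * (2 * real j - (real n - 1)) / m)) =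
     (\<Sum>j<n. sin (pi * (2 * real (Suc j) - real n) / m) - sin (pi * (2 * real j - real n) / m))"
    unfolding sum_distrib_left telescope ..
  also have "\<dots> = sin (pi * (2 * real n - real n) / m) - sin (pi * (2 * real 0 - real n) / m)"
    by (rule sum_lessThan_telescope)
  also have "\<dots> = 2 * sin (real n * pi / m)"
    by (simp add: mult.commute)
  finally show ?thesis using s m by (simp add: sine_quotient_def field_simps)
qed

subsection \<open>Points, steps and the alcove\<close>

definition distinct_points :: "nat \<Rightarrow> nat \<Rightarrow> int vec set" where
  "distinct_points n m =
     {p \<in> carrier_vec n. \<forall>h<n. \<forall>t<n. h \<noteq> t \<longrightarrow> \<not> [p $ h = p $ t] (mod int m)}"

text \<open>An alcove of the affine Weyl group of type A, unbounded along the diagonal. The boundary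
  case of each strict inequality, including the wrap-around one, is a collision modulo
  \<open>m\<close> if \<open>n > 1\<close>.\<close>

definition alcove :: "nat \<Rightarrow> nat \<Rightarrow> int vec set" where
  "alcove n m =
     {p \<in> carrier_vec n. (\<forall>i. Suc i < n \<longrightarrow> p $ Suc i < p $ i) \<and> p $ 0 - int m < p $ (n - 1)}"

definition box :: "nat \<Rightarrow> nat \<Rightarrow> int vec set" where
  "box n m = {p \<in> carrier_vec n. \<forall>i<n. 0 \<le> p $ i \<and> p $ i < int m}"

definition sine_vandermonde :: "nat \<Rightarrow> nat \<Rightarrow> int vec \<Rightarrow> real" where
  "sine_vandermonde n m p =
     (\<Prod>(h, t) \<in> {(h, t). h < t \<and> t < n}. sin (pi * of_int (p $ h - p $ t) / real m))"

lemma sine_product_eq: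
  "sine_product n m a b = sine_vandermonde n m a * \<bar>sine_vandermonde n m b\<bar>"
  unfolding sine_product_def sine_vandermonde_def abs_prod prod.distrib[symmetric]
  by (rule prod.cong) auto

lemma sine_vandermonde_eq_prod:
  "sine_vandermonde n m p = (\<Prod>t<n. \<Prod>h<t. sin (pi * of_int (p $ h - p $ t) / real m))"
  unfolding sine_vandermonde_def by (rule prod_pairs_less)

lemma standard_step_carrier: "e \<in> standard_steps n \<Longrightarrow> e \<in> carrier_vec n"
  by (auto simp: standard_steps_def)

lemma uminus_standard_step: "e \<in> standard_steps n \<Longrightarrow> - e \<in> standard_steps n"
  by (auto simp: standard_steps_def)

lemma standard_step_cases:
  assumes "e \<in> standard_steps n"
  obtains j where "j < n" "e = unit_vec n j" | j where "j < n" "e = - unit_vec n j"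
  using assms by (auto simp: standard_steps_def)

lemma unit_vec_in_standard_steps: "j < n \<Longrightarrow> unit_vec n j \<in> standard_steps n"
  by (auto simp: standard_steps_def)

text \<open>The \<open>2 * n\<close> steps are different integer vectors, even if opposite steps
  have the same effect on the circle.\<close>

lemma sum_standard_steps:
  "(\<Sum>e\<in>standard_steps n. f e) = (\<Sum>j<n. f (unit_vec n j) + f (- unit_vec n j))"
proof -
  have inj: "inj_on (unit_vec n :: nat \<Rightarrow> int vec) {..<n}"
    by (auto simp: inj_on_def)
  have inj': "inj_on (\<lambda>j. - unit_vec n j :: int vec) {..<n}"
    using inj by (auto simp: inj_on_def)
  have disj: "unit_vec n ` {..<n} \<inter> (\<lambda>j. - unit_vec n j :: int vec) ` {..<n} = {}"
  proof -
    have "(unit_vec n i :: int vec) \<noteq> - unit_vec n j" if "i < n" "j < n" for i j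
    proof
      assume "(unit_vec n i :: int vec) = - unit_vec n j"
      then have "(unit_vec n i :: int vec) $ i = (- unit_vec n j) $ i" by simp
      then show False using that by (auto split: if_splits)
    qed
    then show ?thesis by auto
  qed
  have "standard_steps n = unit_vec n ` {..<n} \<union> (\<lambda>j. - unit_vec n j) ` {..<n}"
    by (auto simp: standard_steps_def)
  then have "(\<Sum>e\<in>standard_steps n. f e) =
      (\<Sum>e\<in>unit_vec n ` {..<n}. f e) + (\<Sum>e\<in>(\<lambda>j. - unit_vec n j) ` {..<n}. f e)"
    using disj by (simp add: sum.union_disjoint)
  then show ?thesis
    by (simp add: sum.reindex[OF inj] sum.reindex[OF inj'] sum.distrib)
qed

lemma finite_standard_steps [simp]: "finite (standard_steps n)"
  by (simp add: standard_steps_def)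

lemma standard_step_diff_le:
  assumes "e \<in> standard_steps n" "h < n" "t < n"
  shows "\<bar>e $ h - e $ t\<bar> \<le> 1"
  using assms by (elim standard_step_cases) auto

lemma vec_total_add:
  "dim_vec u = dim_vec v \<Longrightarrow> vec_total (u + v) = vec_total u + vec_total v"
  by (simp add: vec_total_def sum.distrib)

lemma vec_total_unit_vec: "j < n \<Longrightarrow> vec_total (unit_vec n j) = 1"
  by (simp add: vec_total_def unit_vec_def)

lemma odd_vec_total_step:
  assumes "e \<in> standard_steps n"
  shows "odd (vec_total e)"
proof (rule standard_step_cases[OF assms])
  fix j assume "j < n" "e = unit_vec n j"
  then show ?thesis by (simp add: vec_total_unit_vec)
next
  fix j assume j: "j < n" "e = - unit_vec n j"
  have "vec_total e = - vec_total (unit_vec n j)"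
    unfolding vec_total_def j by (simp add: sum_negf[symmetric])
  then show ?thesis using j by (simp add: vec_total_unit_vec)
qed

lemma odd_vec_total_add_step:
  assumes "p \<in> carrier_vec n" "e \<in> standard_steps n"
  shows "even (vec_total (p + e)) \<longleftrightarrow> odd (vec_total p)"
  using assms odd_vec_total_step[OF assms(2)] standard_step_carrier[OF assms(2)]
  by (subst vec_total_add) auto

lemma same_circle_point_refl [simp]: "same_circle_point m p p"
  by (simp add: same_circle_point_def)

lemma same_circle_point_sym: "same_circle_point m p q \<Longrightarrow> same_circle_point m q p"
  by (simp add: same_circle_point_def cong_def)

lemma same_circle_point_trans:
  "same_circle_point m p q \<Longrightarrow> same_circle_point m q r \<Longrightarrow> same_circle_point m p r"
  by (auto simp: same_circle_point_def cong_def)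

lemma same_circle_point_add:
  "same_circle_point m p q \<Longrightarrow> dim_vec e = dim_vec p \<Longrightarrow> same_circle_point m (p + e) (q + e)"
  by (auto simp: same_circle_point_def intro: cong_add)

lemma same_circle_point_carrier:
  "same_circle_point m p q \<Longrightarrow> p \<in> carrier_vec n \<longleftrightarrow> q \<in> carrier_vec n"
  unfolding same_circle_point_def by (metis carrier_vecD carrier_vecI)

section \<open>Representatives of circle points and sums over them\<close>

definition reduce :: "nat \<Rightarrow> int vec \<Rightarrow> int vec" where
  "reduce m p = map_vec (\<lambda>x. x mod int m) p"

lemma reduce_same: "same_circle_point m (reduce m p) p"
  by (auto simp: reduce_def same_circle_point_def cong_def)

lemma reduce_in_box: "m > 0 \<Longrightarrow> p \<in> carrier_vec n \<Longrightarrow> reduce m p \<in> box n m"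
  by (auto simp: reduce_def box_def)

lemma box_same_imp_eq:
  assumes "p \<in> box n m" "q \<in> box n m" "same_circle_point m p q"
  shows "p = q"
  using assms by (intro eq_vecI) (auto simp: box_def same_circle_point_def cong_def)

lemma box_carrier: "p \<in> box n m \<Longrightarrow> p \<in> carrier_vec n"
  by (simp add: box_def)

lemma box_eq_image_PiE: "box n m = vec n ` PiE {..<n} (\<lambda>_. {0..<int m})"
proof (intro equalityI subsetI)
  fix p assume p: "p \<in> box n m"
  have "p = vec n (restrict (($) p) {..<n})"
    by (rule eq_vecI) (use carrier_vecD[OF box_carrier[OF p]] in simp_all)
  moreover have "restrict (($) p) {..<n} \<in> PiE {..<n} (\<lambda>_. {0..<int m})"
    using p unfolding box_def by (intro restrict_PiE_iff[THEN iffD2]) auto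
  ultimately show "p \<in> vec n ` PiE {..<n} (\<lambda>_. {0..<int m})" by blast
next
  fix p assume "p \<in> vec n ` PiE {..<n} (\<lambda>_. {0..<int m})"
  then obtain f where f: "f \<in> PiE {..<n} (\<lambda>_. {0..<int m})" "p = vec n f" by blast
  have "f i \<in> {0..<int m}" if "i < n" for i using PiE_mem[OF f(1)] that by simp
  then show "p \<in> box n m" by (simp add: box_def f(2))
qed

lemma inj_on_vec_PiE: "inj_on (vec n) (PiE {..<n} A)"
proof (rule inj_onI)
  fix f g assume fg: "f \<in> PiE {..<n} A" "g \<in> PiE {..<n} A" and eq: "vec n f = vec n g"
  have "f i = g i" if "i < n" for i
    using arg_cong[OF eq, of "\<lambda>v. v $ i"] that by simp
  then show "f = g" using fg by (intro PiE_ext[of f _ A g]) auto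
qed

lemma finite_box [simp]: "finite (box n m)"
  unfolding box_eq_image_PiE by (intro finite_imageI finite_PiE) auto

lemma sum_box_prod:
  fixes f :: "nat \<Rightarrow> int \<Rightarrow> 'a::comm_semiring_1"
  shows "(\<Sum>p\<in>box n m. \<Prod>h<n. f h (p $ h)) = (\<Prod>h<n. \<Sum>y<m. f h (int y))"
proof -
  have "(\<Sum>p\<in>box n m. \<Prod>h<n. f h (p $ h)) =
      (\<Sum>g\<in>PiE {..<n} (\<lambda>_. {0..<int m}). \<Prod>h<n. f h (g h))"
    unfolding box_eq_image_PiE by (subst sum.reindex[OF inj_on_vec_PiE]) simp
  also have "\<dots> = (\<Prod>h<n. \<Sum>y\<in>{0..<int m}. f h y)"
    by (rule prod_sum_PiE[symmetric]) auto
  also have "\<dots> = (\<Prod>h<n. \<Sum>y<m. f h (int y))"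
    by (intro prod.cong refl sum.reindex_bij_witness[of _ int nat]) auto
  finally show ?thesis .
qed

text \<open>On the finite torus a translation permutes the points. This lets a step be moved from
  one factor of a summed product to the other.\<close>

lemma sum_box_shift:
  assumes "m > 0" and e: "e \<in> carrier_vec n"
    and periodic: "\<And>p q. p \<in> carrier_vec n \<Longrightarrow> same_circle_point m p q \<Longrightarrow> F p = F q"
  shows "(\<Sum>p\<in>box n m. F (p + e)) = (\<Sum>p\<in>box n m. F p)"
proof (rule sum.reindex_bij_witness[of _ "\<lambda>q. reduce m (q + - e)" "\<lambda>p. reduce m (p + e)"])
  fix p assume p: "p \<in> box n m"
  note pc = box_carrier[OF p]
  show "reduce m (p + e) \<in> box n m"
    using p e assms(1) by (intro reduce_in_box) (auto simp: box_carrier)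
  show "reduce m (reduce m (p + e) + - e) = p"
  proof (rule box_same_imp_eq[OF reduce_in_box p])
    have "same_circle_point m (reduce m (p + e) + - e) ((p + e) + - e)"
      using e pc by (intro same_circle_point_add reduce_same) (simp add: reduce_def)
    moreover have "(p + e) + - e = p" using e pc by (intro eq_vecI) auto
    ultimately show "same_circle_point m (reduce m (reduce m (p + e) + - e)) p"
      using same_circle_point_trans[OF reduce_same] by simp
  qed (use assms(1) e pc in \<open>auto simp: reduce_def\<close>)
  show "F (reduce m (p + e)) = F (p + e)"
    using e pc same_circle_point_carrier[OF reduce_same]
    by (intro periodic) (auto simp: reduce_same)
next
  fix q assume q: "q \<in> box n m"
  note qc = box_carrier[OF q]
  show "reduce m (q + - e) \<in> box n m"
    using q e assms(1) by (intro reduce_in_box) (auto simp: box_carrier)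
  show "reduce m (reduce m (q + - e) + e) = q"
  proof (rule box_same_imp_eq[OF reduce_in_box q])
    have "same_circle_point m (reduce m (q + - e) + e) ((q + - e) + e)"
      using e qc by (intro same_circle_point_add reduce_same) (simp add: reduce_def)
    moreover have "(q + - e) + e = q" using e qc by (intro eq_vecI) auto
    ultimately show "same_circle_point m (reduce m (reduce m (q + - e) + e)) q"
      using same_circle_point_trans[OF reduce_same] by simp
  qed (use assms(1) e qc in \<open>auto simp: reduce_def\<close>)
qed

section \<open>Noncolliding configurations and the alcove\<close>

locale circle =
  fixes n m :: nat
  assumes n_pos: "n \<ge> 1" and n_le_m: "n \<le> m"
begin

lemma m_pos: "m > 0" using n_pos n_le_m by simp

abbreviation "W \<equiv> alcove n m"
abbreviation "V \<equiv> sine_vandermonde n m"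
abbreviation "\<rho> \<equiv> 2 * sine_quotient n m"

lemma alcove_carrier: "p \<in> W \<Longrightarrow> p \<in> carrier_vec n"
  by (simp add: alcove_def)

lemma distinct_carrier: "p \<in> distinct_points n m \<Longrightarrow> p \<in> carrier_vec n"
  by (simp add: distinct_points_def)

lemma alcove_less:
  assumes "p \<in> W" "h < t" "t < n"
  shows "p $ t < p $ h"
  using assms(2,3)
proof (induction t)
  case (Suc t)
  have "p $ Suc t < p $ t" using assms(1) Suc by (simp add: alcove_def)
  with Suc show ?case by (cases "h = t") auto
qed simp

lemma alcove_gap:
  assumes "p \<in> W" "h < n" "t < n"
  shows "p $ h - p $ t < int m"
proof -
  have "p $ h \<le> p $ 0" using alcove_less[OF assms(1), of 0 h] assms by (cases "h = 0") auto
  moreover have "p $ (n - 1) \<le> p $ t"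
    using alcove_less[OF assms(1), of t "n - 1"] assms by (cases "t < n - 1"; cases "t = n - 1") auto
  moreover have "p $ 0 - int m < p $ (n - 1)" using assms by (simp add: alcove_def)
  ultimately show ?thesis by linarith
qed

lemma small_not_cong:
  fixes a b :: int
  assumes "a \<noteq> b" "\<bar>a - b\<bar> < int m"
  shows "\<not> [a = b] (mod int m)"
  using assms dvd_imp_le_int[of "a - b" "int m"] by (auto simp: cong_iff_dvd_diff)

lemma alcove_distinct: "p \<in> W \<Longrightarrow> p \<in> distinct_points n m"
  unfolding distinct_points_def
proof (intro CollectI conjI allI impI)
  fix h t assume p: "p \<in> W" and *: "h < n" "t < n" "h \<noteq> t"
  have "p $ h \<noteq> p $ t" using alcove_less[OF p] * by (metis linorder_neqE_nat order.irrefl)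
  moreover have "\<bar>p $ h - p $ t\<bar> < int m"
    using alcove_gap[OF p, of h t] alcove_gap[OF p, of t h] * by auto
  ultimately show "\<not> [p $ h = p $ t] (mod int m)" by (rule small_not_cong)
qed (simp add: alcove_carrier)

text \<open>One step changes the difference of two coordinates by at most \<open>1\<close>, so a
  strict inequality between integers can only break by becoming an equality. Such an equality is a
  collision, also at the wrap-around wall.\<close>

lemma alcove_step:
  assumes p: "p \<in> W" and e: "e \<in> standard_steps n" and d: "p + e \<in> distinct_points n m"
  shows "p + e \<in> W"
proof -
  have ec: "e \<in> carrier_vec n" using e by (rule standard_step_carrier)
  have neq: "\<not> [p $ h + e $ h = p $ t + e $ t] (mod int m)" if "h < n" "t < n" "h \<noteq> t" for h t
    using d that ec by (auto simp: distinct_points_def)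
  have "p $ Suc i + e $ Suc i < p $ i + e $ i" if i: "Suc i < n" for i
  proof -
    have "p $ Suc i < p $ i" using p i by (simp add: alcove_def)
    moreover have "p $ Suc i + e $ Suc i \<noteq> p $ i + e $ i" using neq[of "Suc i" i] i by auto
    moreover have "\<bar>e $ Suc i - e $ i\<bar> \<le> 1" using i by (intro standard_step_diff_le[OF e]) auto
    ultimately show ?thesis by linarith
  qed
  moreover have "p $ 0 + e $ 0 - int m < p $ (n - 1) + e $ (n - 1)"
  \<comment> \<open>For \<open>n = 1\<close> the first and the last coordinate are the same one, so
    no collision condition is available; the inequality is just \<open>m > 0\<close>.\<close>
  proof (cases "n = 1")
    case True
    then show ?thesis using m_pos by simp
  next
    case False
    then have "\<not> [p $ 0 + e $ 0 = p $ (n - 1) + e $ (n - 1)] (mod int m)"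
      using n_pos by (intro neq) auto
    then have "p $ 0 + e $ 0 - int m \<noteq> p $ (n - 1) + e $ (n - 1)"
      unfolding cong_iff_dvd_diff by (metis add_diff_cancel_left' diff_diff_eq2 dvd_refl add_diff_cancel diff_add_cancel)
    moreover have "p $ 0 - int m < p $ (n - 1)" using p by (simp add: alcove_def)
    moreover have "\<bar>e $ 0 - e $ (n - 1)\<bar> \<le> 1" using n_pos by (intro standard_step_diff_le[OF e]) auto
    ultimately show ?thesis by linarith
  qed
  ultimately show ?thesis using ec n_pos alcove_carrier[OF p] by (auto simp: alcove_def)
qed

lemma distinct_same: "same_circle_point m p q \<Longrightarrow> p \<in> distinct_points n m \<Longrightarrow> q \<in> distinct_points n m"
proof -
  assume *: "same_circle_point m p q" and p: "p \<in> distinct_points n m"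
  have pc: "p \<in> carrier_vec n" using p by (rule distinct_carrier)
  have c: "[p $ i = q $ i] (mod int m)" if "i < n" for i
    using * pc that by (auto simp: same_circle_point_def)
  have "\<not> [q $ h = q $ t] (mod int m)" if ht: "h < n" "t < n" "h \<noteq> t" for h t
  proof
    assume "[q $ h = q $ t] (mod int m)"
    then have "[p $ h = p $ t] (mod int m)"
      using c[OF ht(1)] c[OF ht(2)] by (simp add: cong_def)
    then show False using p ht by (auto simp: distinct_points_def)
  qed
  then show ?thesis using same_circle_point_carrier[OF *] pc by (auto simp: distinct_points_def)
qed

text \<open>Once the coordinates at index \<open>0\<close> are aligned, each other one lies among
  the \<open>m\<close> consecutive integers ending there, where its residue determines it.\<close>

lemma alcove_same_shift:
  assumes "p \<in> W" "q \<in> W" "same_circle_point m p q"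
  shows "\<exists>N. \<forall>i<n. p $ i = q $ i + N * int m"
proof -
  have c: "[p $ i = q $ i] (mod int m)" if "i < n" for i
    using assms that carrier_vecD[OF alcove_carrier[OF assms(1)]] by (auto simp: same_circle_point_def)
  obtain N where N: "p $ 0 = q $ 0 + N * int m"
  proof -
    have "[q $ 0 = p $ 0] (mod int m)" using c[of 0] n_pos by (simp add: cong_sym_eq)
    then show ?thesis using that by (auto simp: cong_iff_lin mult.commute)
  qed
  have "p $ i = q $ i + N * int m" if i: "i < n" for i
  proof (rule ccontr)
    assume neq: "p $ i \<noteq> q $ i + N * int m"
    have "p $ 0 - p $ i < int m" "q $ 0 - q $ i < int m"
      using i n_pos by (auto intro!: alcove_gap assms)
    moreover have "p $ i \<le> p $ 0" "q $ i \<le> q $ 0"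
      using alcove_less[OF assms(1), of 0 i] alcove_less[OF assms(2), of 0 i] i by (cases "i = 0"; auto)+
    ultimately have "\<bar>p $ i - (q $ i + N * int m)\<bar> < int m" using N by linarith
    then have "\<not> [p $ i = q $ i + N * int m] (mod int m)" using neq by (intro small_not_cong) auto
    then show False using c[OF i] by (simp add: cong_def)
  qed
  then show ?thesis by blast
qed

subsection \<open>The eigenfunction\<close>

lemma V_pos: "p \<in> W \<Longrightarrow> V p > 0"
  unfolding sine_vandermonde_def
proof (intro prod_pos ballI, clarify)
  fix h t assume p: "p \<in> W" and *: "h < t" "t < n"
  let ?d = "real_of_int (p $ h - p $ t)"
  have "p $ h - p $ t < int m" using * by (intro alcove_gap p) auto
  then have "?d < m" by linarith
  then have "pi * ?d < pi * m" by simp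
  moreover have "?d > 0" using alcove_less[OF p *] by simp
  ultimately show "sin (pi * ?d / m) > 0"
    using m_pos by (intro sin_gt_zero) (auto simp: field_simps)
qed

lemma V_zero:
  assumes "p \<in> carrier_vec n" "p \<notin> distinct_points n m"
  shows "V p = 0"
proof -
  obtain a b where "a < n" "b < n" "a \<noteq> b" "[p $ a = p $ b] (mod int m)"
    using assms by (auto simp: distinct_points_def)
  then obtain h t where ht: "h < t" "t < n" "[p $ h = p $ t] (mod int m)"
    by (metis cong_sym linorder_neqE_nat)
  then obtain k where "p $ h - p $ t = int m * k"
    by (auto simp: cong_iff_dvd_diff elim: dvdE)
  then have "pi * real_of_int (p $ h - p $ t) / m = of_int k * pi"
    using m_pos by (simp add: field_simps)
  then have "sin (pi * real_of_int (p $ h - p $ t) / m) = 0"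
    by (metis mult.commute sin_npi_int)
  moreover have "finite {(h, t). h < t \<and> t < n}"
    by (rule finite_subset[of _ "{..<n} \<times> {..<n}"]) auto
  ultimately show ?thesis unfolding sine_vandermonde_def
    using ht by (intro prod_zero) (auto intro!: bexI[of _ "(h, t)"])
qed

text \<open>Adding \<open>m\<close> to one coordinate changes the arguments of the
  \<open>n - 1\<close> sines that contain it by \<pi> and so flips their signs. Only the absolute
  value is periodic for every \<open>n\<close>.\<close>

lemma abs_V_same:
  assumes "p \<in> carrier_vec n" "same_circle_point m p q"
  shows "\<bar>V p\<bar> = \<bar>V q\<bar>"
  unfolding sine_vandermonde_def abs_prod
proof (rule prod.cong[OF refl], clarify)
  fix h t assume *: "h < t" "t < n"
  have "[p $ h - p $ t = q $ h - q $ t] (mod int m)"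
    using * assms by (intro cong_diff) (auto simp: same_circle_point_def)
  then obtain k where k: "p $ h - p $ t = (q $ h - q $ t) + int m * k"
    by (metis cong_iff_lin cong_sym_eq)
  have "pi * real_of_int (p $ h - p $ t) / m = pi * real_of_int (q $ h - q $ t) / m + of_int k * pi"
    unfolding k using m_pos by (simp add: field_simps)
  then show "\<bar>sin (pi * real_of_int (p $ h - p $ t) / m)\<bar> = \<bar>sin (pi * real_of_int (q $ h - q $ t) / m)\<bar>"
    using sin_zero_abs_cos_one[of "of_int k * pi"] sin_npi_int[of k]
    by (simp add: sin_add abs_mult mult.commute)
qed

text \<open>The Leibniz expansion of a determinant of \<open>n\<close> plane waves, as in the ground
  state of free fermions. The frequencies are spaced by \<open>2 * pi / m\<close> and centred at
  \<open>0\<close>; for even \<open>n\<close> they are odd multiples of \<open>pi / m\<close>, which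
  causes the change of sign when one coordinate moves by \<open>m\<close>.\<close>

definition slater :: "int vec \<Rightarrow> complex" where
  "slater p = (\<Sum>\<sigma> | \<sigma> permutes {..<n}. signof \<sigma> *
     (\<Prod>h<n. cis (pi * (2 * real (\<sigma> h) - (real n - 1)) / real m * of_int (p $ h))))"

lemma slater_eq: "slater p = (\<Prod>t<n. \<Prod>h<t. - 2 * \<i>) * V p"
proof -
  have "slater p = (\<Sum>\<sigma> | \<sigma> permutes {..<n}. signof \<sigma> *
     (\<Prod>h<n. cis ((2 * real (\<sigma> h) - (real n - 1)) * (pi * of_int (p $ h) / real m))))"
    by (simp add: slater_def field_simps)
  also have "\<dots> = (\<Prod>t<n. \<Prod>h<t. 2 * \<i> * sin (pi * of_int (p $ t) / real m - pi * of_int (p $ h) / real m))"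
    by (rule slater_eq_prod_sin)
  \<comment> \<open>\<open>V\<close> subtracts the coordinate with the larger index, the Vandermonde
    product the one with the smaller index; hence the minus sign in each factor.\<close>
  also have "\<dots> = (\<Prod>t<n. \<Prod>h<t. (- 2 * \<i>) * sin (pi * of_int (p $ h - p $ t) / real m))"
  proof (intro prod.cong refl)
    fix t h
    have "pi * of_int (p $ t) / real m - pi * of_int (p $ h) / real m = - (pi * of_int (p $ h - p $ t) / real m)"
      by (simp add: diff_divide_distrib right_diff_distrib)
    then show "2 * \<i> * sin (pi * of_int (p $ t) / real m - pi * of_int (p $ h) / real m) =
       (- 2 * \<i>) * sin (pi * of_int (p $ h - p $ t) / real m)" by (simp only: sin_minus) simp
  qed
  also have "\<dots> = (\<Prod>t<n. \<Prod>h<t. - 2 * \<i>) * V p"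
    unfolding prod.distrib sine_vandermonde_eq_prod by simp
  finally show ?thesis .
qed

text \<open>Each product of plane waves is an eigenfunction: the two opposite steps in one
  coordinate multiply it by twice the cosine of the frequency used there. Different permutations
  only reorder these cosines, so all terms share one eigenvalue.\<close>

lemma slater_step_sum:
  assumes p: "p \<in> carrier_vec n"
  shows "(\<Sum>j<n. slater (p + unit_vec n j) + slater (p + - unit_vec n j)) = \<rho> * slater p"
proof -
  define \<alpha> where "\<alpha> j = pi * (2 * real j - (real n - 1)) / real m" for j
  have slater: "slater q = (\<Sum>\<sigma> | \<sigma> permutes {..<n}. signof \<sigma> * (\<Prod>h<n. cis (\<alpha> (\<sigma> h) * of_int (q $ h))))" for q
    by (simp add: slater_def \<alpha>_def)
  have shift: "(\<Prod>h<n. cis (\<alpha> (\<sigma> h) * of_int ((p + c) $ h))) =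
      (\<Prod>h<n. cis (\<alpha> (\<sigma> h) * of_int (p $ h))) * cis (\<alpha> (\<sigma> j) * s)"
    if "j < n" "c \<in> carrier_vec n" "c $ j = s" "\<And>i. i < n \<Longrightarrow> i \<noteq> j \<Longrightarrow> c $ i = 0" for \<sigma> j c s
  proof -
    have "(\<Prod>h<n. cis (\<alpha> (\<sigma> h) * of_int ((p + c) $ h))) =
       (\<Prod>h<n. cis (\<alpha> (\<sigma> h) * of_int (p $ h)) * (if h = j then cis (\<alpha> (\<sigma> j) * s) else 1))"
      using that by (intro prod.cong refl) (auto simp: cis_mult algebra_simps)
    then show ?thesis using that by (simp add: prod.distrib prod.delta)
  qed
  have "(\<Sum>j<n. slater (p + unit_vec n j) + slater (p + - unit_vec n j)) =
    (\<Sum>j<n. \<Sum>\<sigma> | \<sigma> permutes {..<n}. signof \<sigma> * (\<Prod>h<n. cis (\<alpha> (\<sigma> h) * of_int (p $ h))) * (2 * cos (\<alpha> (\<sigma> j))))"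
    unfolding slater sum.distrib[symmetric]
  proof (intro sum.cong refl)
    fix j \<sigma> assume "j \<in> {..<n}"
    then have j: "j < n" by simp
    have "(\<Prod>h<n. cis (\<alpha> (\<sigma> h) * of_int ((p + unit_vec n j) $ h))) =
        (\<Prod>h<n. cis (\<alpha> (\<sigma> h) * of_int (p $ h))) * cis (\<alpha> (\<sigma> j))"
      using j by (subst shift[of j _ 1]) auto
    moreover have "(\<Prod>h<n. cis (\<alpha> (\<sigma> h) * of_int ((p + - unit_vec n j) $ h))) =
        (\<Prod>h<n. cis (\<alpha> (\<sigma> h) * of_int (p $ h))) * cis (- \<alpha> (\<sigma> j))"
      using j by (subst shift[of j _ "-1"]) auto
    moreover have "cis (\<alpha> (\<sigma> j)) + cis (- \<alpha> (\<sigma> j)) = 2 * cos (\<alpha> (\<sigma> j))"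
      by (simp add: complex_eq_iff)
    ultimately show "signof \<sigma> * (\<Prod>h<n. cis (\<alpha> (\<sigma> h) * of_int ((p + unit_vec n j) $ h))) +
        signof \<sigma> * (\<Prod>h<n. cis (\<alpha> (\<sigma> h) * of_int ((p + - unit_vec n j) $ h))) =
        signof \<sigma> * (\<Prod>h<n. cis (\<alpha> (\<sigma> h) * of_int (p $ h))) * (2 * cos (\<alpha> (\<sigma> j)))"
      by (simp add: distrib_left[symmetric] mult.assoc)
  qed
  also have "\<dots> = (\<Sum>\<sigma> | \<sigma> permutes {..<n}. signof \<sigma> * (\<Prod>h<n. cis (\<alpha> (\<sigma> h) * of_int (p $ h))) * of_real (\<Sum>j<n. 2 * cos (\<alpha> (\<sigma> j))))"
    by (subst sum.swap) (simp add: sum_distrib_left)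
  also have "\<dots> = (\<Sum>\<sigma> | \<sigma> permutes {..<n}. signof \<sigma> * (\<Prod>h<n. cis (\<alpha> (\<sigma> h) * of_int (p $ h))) * of_real \<rho>)"
  proof (intro sum.cong refl, clarify)
    fix \<sigma> assume \<sigma>: "\<sigma> permutes {..<n}"
    have "(\<Sum>j<n. 2 * cos (\<alpha> (\<sigma> j))) = (\<Sum>j<n. 2 * cos (\<alpha> j))"
      using sum.permute[OF \<sigma>, of "\<lambda>j. 2 * cos (\<alpha> j)"] by (simp add: o_def)
    also have "\<dots> = \<rho>"
      unfolding \<alpha>_def using n_pos n_le_m by (intro sum_cos_arithmetic) auto
    finally show "signof \<sigma> * (\<Prod>h<n. cis (\<alpha> (\<sigma> h) * of_int (p $ h))) * complex_of_real (\<Sum>j<n. 2 * cos (\<alpha> (\<sigma> j))) =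
      signof \<sigma> * (\<Prod>h<n. cis (\<alpha> (\<sigma> h) * of_int (p $ h))) * complex_of_real \<rho>" by simp
  qed
  also have "\<dots> = \<rho> * slater p"
    by (simp add: slater sum_distrib_left mult_ac)
  finally show ?thesis .
qed

lemma V_step_sum:
  assumes p: "p \<in> carrier_vec n"
  shows "(\<Sum>e\<in>standard_steps n. V (p + e)) = \<rho> * V p"
proof -
  define \<kappa> where "\<kappa> = (\<Prod>t<n. \<Prod>h<t. - 2 * \<i>)"
  have "\<kappa> \<noteq> 0" by (simp add: \<kappa>_def)
  have "\<kappa> * of_real (\<Sum>j<n. V (p + unit_vec n j) + V (p + - unit_vec n j)) = \<kappa> * of_real (\<rho> * V p)"
    using slater_step_sum[OF p] unfolding slater_eq \<kappa>_def[symmetric]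
    by (simp add: sum_distrib_left algebra_simps)
  then show ?thesis using \<open>\<kappa> \<noteq> 0\<close> unfolding sum_standard_steps
    by (simp only: mult_cancel_left of_real_eq_iff) simp
qed

text \<open>A neighbour of an alcove point either stays in the alcove, where \<open>V\<close> is
  positive, or collides, where \<open>V\<close> is zero; so absolute values change nothing.\<close>

lemma abs_V_step_sum_alcove:
  assumes p: "p \<in> W"
  shows "(\<Sum>e\<in>standard_steps n. \<bar>V (p + e)\<bar>) = \<rho> * \<bar>V p\<bar>"
proof -
  have "V (p + e) \<ge> 0" if "e \<in> standard_steps n" for e
  proof (cases "p + e \<in> distinct_points n m")
    case True
    then show ?thesis using V_pos[OF alcove_step[OF p that]] by simp
  next
    case False
    then show ?thesis
      using V_zero[of "p + e"] alcove_carrier[OF p] standard_step_carrier[OF that] by simp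
  qed
  then have "(\<Sum>e\<in>standard_steps n. \<bar>V (p + e)\<bar>) = (\<Sum>e\<in>standard_steps n. V (p + e))"
    by (intro sum.cong) auto
  then show ?thesis using V_step_sum[OF alcove_carrier[OF p]] V_pos[OF p] by simp
qed

text \<open>Periodicity of \<open>\<bar>V\<bar>\<close> carries the equation from the alcove to all
  representatives of its points. At a collision it can fail, since \<open>V\<close> vanishes there
  but need not vanish at the neighbours.\<close>

lemma abs_V_step_sum:
  assumes p: "p \<in> W" and pq: "same_circle_point m p q"
  shows "(\<Sum>e\<in>standard_steps n. \<bar>V (q + e)\<bar>) = \<rho> * \<bar>V q\<bar>"
proof -
  have "\<bar>V (p + e)\<bar> = \<bar>V (q + e)\<bar>" if "e \<in> standard_steps n" for e
    using standard_step_carrier[OF that] alcove_carrier[OF p]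
    by (intro abs_V_same same_circle_point_add pq) auto
  then show ?thesis
    using abs_V_step_sum_alcove[OF p] abs_V_same[OF alcove_carrier[OF p] pq] by simp
qed

end

subsection \<open>Counting walks\<close>

lemma noncolliding_circle_walks_0:
  assumes "a \<in> carrier_vec n"
  shows "noncolliding_circle_walks n m a b 0 =
    (if a \<in> distinct_points n m \<and> same_circle_point m a b then {[a]} else {})"
proof -
  have "p \<in> noncolliding_circle_walks n m a b 0 \<longleftrightarrow>
      p = [a] \<and> a \<in> distinct_points n m \<and> same_circle_point m a b" for p
    using assms
    by (auto simp: noncolliding_circle_walks_def circle_walks_def distinct_points_def length_Suc_conv)
  then show ?thesis by auto
qed

lemma Cons_in_noncolliding_circle_walks:
  assumes "a \<in> carrier_vec n"
  shows "x # q \<in> noncolliding_circle_walks n m a b (Suc k) \<longleftrightarrow>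
    x = a \<and> a \<in> distinct_points n m \<and>
    (\<exists>e\<in>standard_steps n. q \<in> noncolliding_circle_walks n m (a + e) b k)"
proof
  assume "x # q \<in> noncolliding_circle_walks n m a b (Suc k)"
  then have w: "length q = Suc k" "set q \<subseteq> carrier_vec n" "x = a" "same_circle_point m (q ! k) b"
    and st: "\<And>i. i < Suc k \<Longrightarrow> (x # q) ! Suc i - (x # q) ! i \<in> standard_steps n"
    and nc: "\<And>i h t. i \<le> Suc k \<Longrightarrow> h < n \<Longrightarrow> t < n \<Longrightarrow> h \<noteq> t \<Longrightarrow>
       \<not> [(x # q) ! i $ h = (x # q) ! i $ t] (mod int m)"
    by (auto simp: noncolliding_circle_walks_def circle_walks_def)
  have d: "a \<in> distinct_points n m"
    using nc[of 0] assms w by (auto simp: distinct_points_def)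
  define e where "e = q ! 0 - a"
  have e: "e \<in> standard_steps n" using st[of 0] w by (simp add: e_def)
  have "q ! 0 \<in> carrier_vec n" using w by auto
  then have q0: "q ! 0 = a + e" unfolding e_def using assms by (intro eq_vecI) auto
  have "q ! Suc i - q ! i \<in> standard_steps n" if "i < k" for i
    using st[of "Suc i"] that by simp
  moreover have "\<not> [q ! i $ h = q ! i $ t] (mod int m)" if "i \<le> k" "h < n" "t < n" "h \<noteq> t" for i h t
    using nc[of "Suc i"] that by simp
  ultimately have "q \<in> noncolliding_circle_walks n m (a + e) b k"
    using w q0 unfolding noncolliding_circle_walks_def circle_walks_def by blast
  then show "x = a \<and> a \<in> distinct_points n m \<and>
      (\<exists>e\<in>standard_steps n. q \<in> noncolliding_circle_walks n m (a + e) b k)"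
    using w d e by blast
next
  assume "x = a \<and> a \<in> distinct_points n m \<and>
      (\<exists>e\<in>standard_steps n. q \<in> noncolliding_circle_walks n m (a + e) b k)"
  then obtain e where x: "x = a" and d: "a \<in> distinct_points n m" and e: "e \<in> standard_steps n"
    and q: "q \<in> noncolliding_circle_walks n m (a + e) b k" by blast
  have w: "length q = Suc k" "set q \<subseteq> carrier_vec n" "q ! 0 = a + e" "same_circle_point m (q ! k) b"
    and st: "\<And>i. i < k \<Longrightarrow> q ! Suc i - q ! i \<in> standard_steps n"
    and nc: "\<And>i h t. i \<le> k \<Longrightarrow> h < n \<Longrightarrow> t < n \<Longrightarrow> h \<noteq> t \<Longrightarrow>
       \<not> [q ! i $ h = q ! i $ t] (mod int m)"
    using q by (auto simp: noncolliding_circle_walks_def circle_walks_def)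
  have "a + e - a = e" using assms standard_step_carrier[OF e] by (intro eq_vecI) auto
  then have "(x # q) ! Suc i - (x # q) ! i \<in> standard_steps n" if "i < Suc k" for i
    using that st[of "i - 1"] w(3) x e by (cases i) auto
  moreover have "\<not> [(x # q) ! i $ h = (x # q) ! i $ t] (mod int m)"
    if "i \<le> Suc k" "h < n" "t < n" "h \<noteq> t" for i h t
  proof (cases i)
    case 0
    then show ?thesis using that d x by (simp add: distinct_points_def)
  next
    case (Suc j)
    then show ?thesis using that nc[of j h t] by simp
  qed
  ultimately show "x # q \<in> noncolliding_circle_walks n m a b (Suc k)"
    unfolding noncolliding_circle_walks_def circle_walks_def using w x assms by simp
qed

lemma noncolliding_circle_walks_Suc:
  assumes "a \<in> carrier_vec n"
  shows "noncolliding_circle_walks n m a b (Suc k) =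
    (if a \<in> distinct_points n m
     then \<Union>e\<in>standard_steps n. (#) a ` noncolliding_circle_walks n m (a + e) b k else {})"
proof -
  have "p \<noteq> []" if "p \<in> noncolliding_circle_walks n m a b (Suc k)" for p
    using that by (auto simp: noncolliding_circle_walks_def circle_walks_def)
  then have "p \<in> noncolliding_circle_walks n m a b (Suc k) \<longleftrightarrow>
      a \<in> distinct_points n m \<and>
      (\<exists>e\<in>standard_steps n. \<exists>q. p = a # q \<and> q \<in> noncolliding_circle_walks n m (a + e) b k)" for p
    using Cons_in_noncolliding_circle_walks[OF assms, of "hd p" "tl p" m b k]
    by (cases p) (auto simp: Cons_in_noncolliding_circle_walks[OF assms])
  then show ?thesis by (simp add: set_eq_iff image_iff) blast
qed

lemma finite_noncolliding_circle_walks: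
  "a \<in> carrier_vec n \<Longrightarrow> finite (noncolliding_circle_walks n m a b k)"
proof (induction k arbitrary: a)
  case 0
  then show ?case by (simp add: noncolliding_circle_walks_0)
next
  case (Suc k)
  have "finite (noncolliding_circle_walks n m (a + e) b k)" if "e \<in> standard_steps n" for e
    using Suc.prems standard_step_carrier[OF that] by (intro Suc.IH) simp
  then show ?case by (simp add: noncolliding_circle_walks_Suc[OF Suc.prems])
qed

text \<open>Walks are recorded as integer vectors, so different first steps lead to different second
  points and the union is disjoint, even when the steps agree modulo \<open>m\<close>.\<close>

lemma card_noncolliding_circle_walks_Suc:
  assumes a: "a \<in> carrier_vec n"
  shows "card (noncolliding_circle_walks n m a b (Suc k)) =
    (if a \<in> distinct_points n m
     then \<Sum>e\<in>standard_steps n. card (noncolliding_circle_walks n m (a + e) b k) else 0)"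
proof (cases "a \<in> distinct_points n m")
  case True
  have disjoint: "(#) a ` noncolliding_circle_walks n m (a + e) b k \<inter>
      (#) a ` noncolliding_circle_walks n m (a + e') b k = {}"
    if "e \<in> standard_steps n" "e' \<in> standard_steps n" "e \<noteq> e'" for e e'
  proof -
    have "a + e = a + e' \<Longrightarrow> e = e'"
    proof (rule eq_vecI)
      fix i assume eq: "a + e = a + e'" and i: "i < dim_vec e'"
      have "(a + e) $ i = (a + e') $ i" by (simp add: eq)
      then show "e $ i = e' $ i"
        using that(1,2) i by (auto dest!: standard_step_carrier)
    qed (use that in \<open>auto dest!: standard_step_carrier\<close>)
    then have "a + e \<noteq> a + e'" using that by blast
    then show ?thesis by (auto simp: noncolliding_circle_walks_def circle_walks_def)
  qed
  have "finite (noncolliding_circle_walks n m (a + e) b k)" if "e \<in> standard_steps n" for e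
    using a standard_step_carrier[OF that] by (intro finite_noncolliding_circle_walks) simp
  then have "card (\<Union>e\<in>standard_steps n. (#) a ` noncolliding_circle_walks n m (a + e) b k) =
      (\<Sum>e\<in>standard_steps n. card ((#) a ` noncolliding_circle_walks n m (a + e) b k))"
    using disjoint by (intro card_UN_disjoint) auto
  then show ?thesis
    using True by (simp add: noncolliding_circle_walks_Suc[OF a] card_image)
qed (simp add: noncolliding_circle_walks_Suc[OF a])

section \<open>Walk counts as functions of the starting point\<close>

context circle
begin

definition walk_count :: "int vec \<Rightarrow> nat \<Rightarrow> int vec \<Rightarrow> real" where
  "walk_count l k p = real (card (noncolliding_circle_walks n m p l k))"

lemma walk_count_0:
  "p \<in> carrier_vec n \<Longrightarrow>
   walk_count l 0 p = (if p \<in> distinct_points n m \<and> same_circle_point m p l then 1 else 0)"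
  by (simp add: walk_count_def noncolliding_circle_walks_0)

lemma walk_count_Suc:
  "p \<in> carrier_vec n \<Longrightarrow>
   walk_count l (Suc k) p =
     (if p \<in> distinct_points n m then \<Sum>e\<in>standard_steps n. walk_count l k (p + e) else 0)"
  by (simp add: walk_count_def card_noncolliding_circle_walks_Suc)

lemma walk_count_nonneg: "walk_count l k p \<ge> 0"
  by (simp add: walk_count_def)

text \<open>This allows the end point to be replaced by its lift in the alcove.\<close>

lemma walk_count_target:
  assumes "same_circle_point m l l'"
  shows "walk_count l k p = walk_count l' k p"
proof -
  have "same_circle_point m v l \<longleftrightarrow> same_circle_point m v l'" for v
    using assms same_circle_point_trans same_circle_point_sym by blast
  then show ?thesis
    by (simp add: walk_count_def noncolliding_circle_walks_def circle_walks_def)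
qed

lemma distinct_same_iff: "same_circle_point m p q \<Longrightarrow> p \<in> distinct_points n m \<longleftrightarrow> q \<in> distinct_points n m"
  using distinct_same same_circle_point_sym by blast

lemma walk_count_same:
  "p \<in> carrier_vec n \<Longrightarrow> same_circle_point m p q \<Longrightarrow> walk_count l k p = walk_count l k q"
proof (induction k arbitrary: p q)
  case 0
  have "q \<in> carrier_vec n" using 0 same_circle_point_carrier by blast
  moreover have "same_circle_point m p l \<longleftrightarrow> same_circle_point m q l"
    using 0 same_circle_point_trans same_circle_point_sym by blast
  ultimately show ?case using 0 distinct_same_iff[of p q] by (simp add: walk_count_0)
next
  case (Suc k)
  have q: "q \<in> carrier_vec n" using Suc.prems same_circle_point_carrier by blast
  have "walk_count l k (p + e) = walk_count l k (q + e)" if "e \<in> standard_steps n" for e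
    using Suc.prems standard_step_carrier[OF that]
    by (intro Suc.IH same_circle_point_add) auto
  then show ?case
    using Suc.prems q distinct_same_iff[of p q] by (simp add: walk_count_Suc)
qed

text \<open>Steps can be reversed: if the next point lifts to the alcove, undoing the step on the
  lift gives a lift of the present point, and \<open>alcove_step\<close> keeps it in the
  alcove.\<close>

lemma walk_count_support:
  assumes l: "l \<in> W"
  shows "p \<in> carrier_vec n \<Longrightarrow> walk_count l k p \<noteq> 0 \<Longrightarrow> \<exists>q\<in>W. same_circle_point m q p"
proof (induction k arbitrary: p)
  case 0
  then show ?case using l same_circle_point_sym by (auto simp: walk_count_0 split: if_splits)
next
  case (Suc k)
  then have d: "p \<in> distinct_points n m" and "(\<Sum>e\<in>standard_steps n. walk_count l k (p + e)) \<noteq> 0"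
    by (auto simp: walk_count_Suc split: if_splits)
  then obtain e where e: "e \<in> standard_steps n" "walk_count l k (p + e) \<noteq> 0"
    by (meson sum.neutral)
  have ec: "e \<in> carrier_vec n" using e(1) by (rule standard_step_carrier)
  obtain q where q: "q \<in> W" "same_circle_point m q (p + e)"
    using Suc.IH[of "p + e"] Suc.prems(1) ec e(2) by auto
  have qc: "q \<in> carrier_vec n" using q(1) by (rule alcove_carrier)
  have "p + e + - e = p" using Suc.prems(1) ec by (intro eq_vecI) auto
  then have same: "same_circle_point m (q + - e) p"
    using same_circle_point_add[OF q(2), of "- e"] qc ec by simp
  then have "q + - e \<in> distinct_points n m" using d distinct_same_iff by blast
  then have "q + - e \<in> W" by (intro alcove_step q uminus_standard_step e)
  then show ?case using same by blast
qed

text \<open>A step out of the alcove is a collision, and no noncolliding walk starts there.\<close>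

lemma walk_count_step_sum:
  assumes p: "p \<in> W"
  shows "walk_count l (Suc k) p =
    (\<Sum>e\<in>{e \<in> standard_steps n. p + e \<in> W}. walk_count l k (p + e))"
proof -
  have "walk_count l k (p + e) = 0" if e: "e \<in> standard_steps n" and "p + e \<notin> W" for e
  proof -
    have "p + e \<notin> distinct_points n m" using alcove_step[OF p e] that by blast
    moreover have "p + e \<in> carrier_vec n"
      using alcove_carrier[OF p] standard_step_carrier[OF e] by simp
    ultimately show ?thesis by (cases k) (simp_all add: walk_count_0 walk_count_Suc)
  qed
  then have "(\<Sum>e\<in>standard_steps n. walk_count l k (p + e)) =
      (\<Sum>e\<in>{e \<in> standard_steps n. p + e \<in> W}. walk_count l k (p + e))"
    by (intro sum.mono_neutral_right) auto
  then show ?thesis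
    using alcove_distinct[OF p] by (simp add: walk_count_Suc alcove_carrier[OF p])
qed

lemma V_alcove_step_sum:
  assumes p: "p \<in> W"
  shows "(\<Sum>e\<in>{e \<in> standard_steps n. p + e \<in> W}. V (p + e)) = \<rho> * V p"
proof -
  have "V (p + e) = 0" if e: "e \<in> standard_steps n" and "p + e \<notin> W" for e
    using alcove_step[OF p e] that alcove_carrier[OF p] standard_step_carrier[OF e]
    by (intro V_zero) auto
  then have "(\<Sum>e\<in>standard_steps n. V (p + e)) =
      (\<Sum>e\<in>{e \<in> standard_steps n. p + e \<in> W}. V (p + e))"
    by (intro sum.mono_neutral_right) auto
  then show ?thesis using V_step_sum[OF alcove_carrier[OF p]] by simp
qed

text \<open>The step operator on the torus is symmetric, so pairing with its eigenfunction gives a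
  geometric sequence.\<close>

lemma weighted_walk_count_sum:
  assumes l: "l \<in> W"
  shows "(\<Sum>x\<in>box n m. \<bar>V x\<bar> * walk_count l k x) = \<rho> ^ k * V l"
proof (induction k)
  case 0
  have lc: "l \<in> carrier_vec n" using l by (rule alcove_carrier)
  have x0: "reduce m l \<in> box n m" using lc m_pos by (intro reduce_in_box)
  have "(\<Sum>x\<in>box n m. \<bar>V x\<bar> * walk_count l 0 x) =
      (\<Sum>x\<in>box n m. if x = reduce m l then \<bar>V x\<bar> else 0)"
  proof (intro sum.cong refl)
    fix x assume x: "x \<in> box n m"
    have "same_circle_point m x l \<longleftrightarrow> x = reduce m l"
      using x x0 box_same_imp_eq reduce_same same_circle_point_trans same_circle_point_sym by metis
    moreover have "same_circle_point m x l \<Longrightarrow> x \<in> distinct_points n m"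
      using distinct_same_iff alcove_distinct[OF l] by blast
    ultimately show "\<bar>V x\<bar> * walk_count l 0 x = (if x = reduce m l then \<bar>V x\<bar> else 0)"
      using box_carrier[OF x] by (auto simp: walk_count_0)
  qed
  also have "\<dots> = \<bar>V (reduce m l)\<bar>" using x0 by (simp add: sum.delta)
  also have "\<dots> = \<bar>V l\<bar>"
    by (rule abs_V_same[symmetric]) (use lc in \<open>auto intro: same_circle_point_sym reduce_same\<close>)
  finally show ?case using V_pos[OF l] by simp
next
  case (Suc k)
  have minus: "x + e + - e = x" if "x \<in> carrier_vec n" "e \<in> standard_steps n" for x e
    using that standard_step_carrier[OF that(2)] by (intro eq_vecI) auto
  \<comment> \<open>\<open>V x\<close> is written as \<open>V (x + e + - e)\<close> so that the
    summand depends on \<open>x\<close> only through \<open>x + e\<close> and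
    \<open>sum_box_shift\<close> applies. At collisions, where the recursion returns
    \<open>0\<close>, the factor \<open>V x\<close> vanishes too, so the sum over all steps may be
    used everywhere.\<close>
  have "(\<Sum>x\<in>box n m. \<bar>V x\<bar> * walk_count l (Suc k) x) =
      (\<Sum>x\<in>box n m. \<Sum>e\<in>standard_steps n. \<bar>V (x + e + - e)\<bar> * walk_count l k (x + e))"
  proof (intro sum.cong refl)
    fix x assume x: "x \<in> box n m"
    have "\<bar>V x\<bar> * walk_count l (Suc k) x = \<bar>V x\<bar> * (\<Sum>e\<in>standard_steps n. walk_count l k (x + e))"
      using V_zero[of x] box_carrier[OF x] by (simp add: walk_count_Suc)
    then show "\<bar>V x\<bar> * walk_count l (Suc k) x =
        (\<Sum>e\<in>standard_steps n. \<bar>V (x + e + - e)\<bar> * walk_count l k (x + e))"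
      by (simp add: sum_distrib_left minus[OF box_carrier[OF x]])
  qed
  also have "\<dots> = (\<Sum>e\<in>standard_steps n. \<Sum>x\<in>box n m. \<bar>V (x + e + - e)\<bar> * walk_count l k (x + e))"
    by (rule sum.swap)
  also have "\<dots> = (\<Sum>e\<in>standard_steps n. \<Sum>x\<in>box n m. \<bar>V (x + - e)\<bar> * walk_count l k x)"
  proof (rule sum.cong[OF refl])
    fix e assume e: "e \<in> standard_steps n"
    have ec: "e \<in> carrier_vec n" using e by (rule standard_step_carrier)
    show "(\<Sum>x\<in>box n m. \<bar>V (x + e + - e)\<bar> * walk_count l k (x + e)) =
        (\<Sum>x\<in>box n m. \<bar>V (x + - e)\<bar> * walk_count l k x)"
      by (rule sum_box_shift[OF m_pos ec, of "\<lambda>x. \<bar>V (x + - e)\<bar> * walk_count l k x"])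
        (use ec in \<open>auto intro!: arg_cong2[of _ _ _ _ times] abs_V_same same_circle_point_add walk_count_same\<close>)
  qed
  also have "\<dots> = (\<Sum>x\<in>box n m. \<Sum>e\<in>standard_steps n. \<bar>V (x + - e)\<bar> * walk_count l k x)"
    by (rule sum.swap)
  also have "\<dots> = (\<Sum>x\<in>box n m. \<rho> * (\<bar>V x\<bar> * walk_count l k x))"
  proof (intro sum.cong refl)
    fix x assume x: "x \<in> box n m"
    have "(\<Sum>e\<in>standard_steps n. \<bar>V (x + - e)\<bar>) = (\<Sum>e\<in>standard_steps n. \<bar>V (x + e)\<bar>)"
      by (rule sum.reindex_bij_witness[of _ uminus uminus]) (auto simp: uminus_standard_step)
    \<comment> \<open>The eigenvalue equation is needed only where walks exist, and such points lift
      to the alcove.\<close>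
    moreover have "(\<Sum>e\<in>standard_steps n. \<bar>V (x + e)\<bar>) = \<rho> * \<bar>V x\<bar>" if "walk_count l k x \<noteq> 0"
      using walk_count_support[OF l box_carrier[OF x] that] abs_V_step_sum by blast
    ultimately show "(\<Sum>e\<in>standard_steps n. \<bar>V (x + - e)\<bar> * walk_count l k x) =
        \<rho> * (\<bar>V x\<bar> * walk_count l k x)"
      by (cases "walk_count l k x = 0") (auto simp: sum_distrib_right[symmetric])
  qed
  also have "\<dots> = \<rho> ^ Suc k * V l"
    by (simp add: sum_distrib_left[symmetric] Suc)
  finally show ?case .
qed

end

subsection \<open>Convergence of repeated averages\<close>

text \<open>A Doeblin argument: the maximum decreases, the minimum increases, and a path of length
  \<open>r\<close> has weight at least \<open>w0 ^ r\<close>, so the oscillation shrinks by the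
  factor \<open>1 - w0 ^ r\<close> in \<open>r\<close> steps. The sets \<open>X k\<close> stand for
  the alternating parity classes. As the alcove is infinite, only a finite range of
  \<open>g k\<close> is asked for, and a target may be replaced by a point with the same
  value.\<close>

lemma averaging_converges:
  fixes g :: "nat \<Rightarrow> 'a \<Rightarrow> real" and w :: "'a \<Rightarrow> 'a \<Rightarrow> real"
  assumes N: "\<And>k x y. x \<in> X (Suc k) \<Longrightarrow> y \<in> N x \<Longrightarrow> y \<in> X k"
    and finite_N: "\<And>k x. x \<in> X k \<Longrightarrow> finite (N x)"
    and w_ge: "\<And>k x y. x \<in> X k \<Longrightarrow> y \<in> N x \<Longrightarrow> w0 \<le> w x y"
    and w0: "0 < w0" "w0 \<le> 1"
    and w_sum: "\<And>k x. x \<in> X k \<Longrightarrow> (\<Sum>y\<in>N x. w x y) = 1"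
    and g_Suc: "\<And>k x. x \<in> X (Suc k) \<Longrightarrow> g (Suc k) x = (\<Sum>y\<in>N x. w x y * g k y)"
    and finite_range: "\<And>k. finite (g k ` X k)"
    and nonempty: "\<And>k. X k \<noteq> {}"
    and reach: "\<And>k x y. x \<in> X (k + r) \<Longrightarrow> y \<in> X k \<Longrightarrow>
       \<exists>y'. g k y' = g k y \<and> (x, y') \<in> {(x, y). y \<in> N x} ^^ r"
  shows "\<exists>L. \<forall>\<epsilon>>0. \<forall>\<^sub>F k in sequentially. \<forall>x\<in>X k. \<bar>g k x - L\<bar> < \<epsilon>"
proof -
  have w_pos: "0 < w x y" if "x \<in> X k" "y \<in> N x" for k x y
    using w_ge[OF that] w0 by linarith
  define b where "b k = Max (g k ` X k)" for k
  define a where "a k = Min (g k ` X k)" for k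
  have g_le: "g k x \<le> b k" and g_ge: "a k \<le> g k x" if "x \<in> X k" for k x
    using that finite_range[of k] by (auto simp: a_def b_def)
  have b_attained: "\<exists>x\<in>X k. g k x = b k" and a_attained: "\<exists>x\<in>X k. g k x = a k" for k
    using Max_in[OF finite_range[of k]] Min_in[OF finite_range[of k]] nonempty[of k]
    by (auto simp: a_def b_def)
  have a_step: "a k \<le> g (Suc k) x" if x: "x \<in> X (Suc k)" for k x
  proof -
    have "a k = (\<Sum>y\<in>N x. w x y * a k)" by (simp add: sum_distrib_right[symmetric] w_sum[OF x])
    also have "\<dots> \<le> g (Suc k) x" unfolding g_Suc[OF x]
      using N[OF x] w_pos[OF x] by (intro sum_mono mult_left_mono g_ge) (auto intro: less_imp_le)
    finally show ?thesis .
  qed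
  have b_step: "g (Suc k) x \<le> b k" if x: "x \<in> X (Suc k)" for k x
  proof -
    have "g (Suc k) x \<le> (\<Sum>y\<in>N x. w x y * b k)" unfolding g_Suc[OF x]
      using N[OF x] w_pos[OF x] by (intro sum_mono mult_left_mono g_le) (auto intro: less_imp_le)
    also have "\<dots> = b k" by (simp add: sum_distrib_right[symmetric] w_sum[OF x])
    finally show ?thesis .
  qed
  have "incseq a" by (intro incseq_SucI) (metis a_attained a_step)
  have "decseq b" by (intro decseq_SucI) (metis b_attained b_step)
  have a_le_b: "a k \<le> b k" for k using b_attained[of k] g_ge by force
  \<comment> \<open>The deficit \<open>b k - g k y\<close> below the maximum is passed back along
    the path and keeps at least the fraction \<open>w0\<close> at each step; all other neighbours
    are bounded by \<open>b k\<close>.\<close>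
  have path: "g (k + r) x \<le> b k - w0 ^ r * (b k - g k y)"
    if "(x, y) \<in> {(x, y). y \<in> N x} ^^ r" "x \<in> X (k + r)" for k r x y
    using that
  proof (induction r arbitrary: x)
    case (Suc r)
    obtain z where z: "z \<in> N x" "(z, y) \<in> {(x, y). y \<in> N x} ^^ r"
      using relpow_Suc_D2[OF Suc.prems(1)] by auto
    have x: "x \<in> X (Suc (k + r))" using Suc.prems(2) by simp
    have zX: "z \<in> X (k + r)" using N[OF x] z by blast
    have IH: "g (k + r) z \<le> b k - w0 ^ r * (b k - g k y)" using Suc.IH z zX by blast
    have le_b: "g (k + r) v \<le> b k" if "v \<in> X (k + r)" for v
      using g_le[OF that] decseqD[OF \<open>decseq b\<close>, of k "k + r"] by simp
    \<comment> \<open>Membership makes the deficit nonnegative, as the comparison of products below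
      requires.\<close>
    have yX: "y \<in> X k" using z(2) zX
    proof (induction r arbitrary: z)
      case (Suc r)
      obtain u where "u \<in> N z" "(u, y) \<in> {(x, y). y \<in> N x} ^^ r"
        using relpow_Suc_D2[OF Suc.prems(1)] by auto
      then show ?case using Suc N[of z "k + r" u] by auto
    qed simp
    have fin: "finite (N x)" using finite_N[OF x] .
    have "g (Suc (k + r)) x = w x z * g (k + r) z + (\<Sum>v\<in>N x - {z}. w x v * g (k + r) v)"
      unfolding g_Suc[OF x] by (rule sum.remove[OF fin z(1)])
    also have "(\<Sum>v\<in>N x - {z}. w x v * g (k + r) v) \<le> (\<Sum>v\<in>N x - {z}. w x v * b k)"
      using N[OF x] w_pos[OF x] by (intro sum_mono mult_left_mono le_b) (auto intro: less_imp_le)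
    also have "\<dots> = b k - w x z * b k"
      using sum.remove[OF fin z(1), of "\<lambda>v. w x v * b k"]
      by (simp add: sum_distrib_right[symmetric] w_sum[OF x] del: sum.remove)
    finally have "g (Suc (k + r)) x \<le> b k - w x z * (b k - g (k + r) z)"
      by (simp add: algebra_simps)
    also have "w0 * (w0 ^ r * (b k - g k y)) \<le> w x z * (b k - g (k + r) z)"
      using w0 w_ge[OF x z(1)] IH g_le[OF yX] by (intro mult_mono) auto
    then have "b k - w x z * (b k - g (k + r) z) \<le> b k - w0 ^ Suc r * (b k - g k y)"
      by (simp add: mult.assoc)
    finally show ?case by simp
  qed simp
  define \<delta> where "\<delta> = w0 ^ r"
  have \<delta>: "0 < \<delta>" using w0 by (simp add: \<delta>_def)
  have contract: "b (k + r) - a (k + r) \<le> (1 - \<delta>) * (b k - a k)" for k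
  proof -
    \<comment> \<open>The path leads from a maximum at time \<open>k + r\<close> to a point with the
      minimal value at time \<open>k\<close>.\<close>
    obtain x where x: "x \<in> X (k + r)" "g (k + r) x = b (k + r)" using b_attained by blast
    obtain y where y: "y \<in> X k" "g k y = a k" using a_attained by blast
    obtain y' where y': "g k y' = a k" "(x, y') \<in> {(x, y). y \<in> N x} ^^ r"
      using reach[OF x(1) y(1)] y(2) by auto
    have "b (k + r) \<le> b k - \<delta> * (b k - a k)"
      using path[OF y'(2) x(1)] x(2) y'(1) by (simp add: \<delta>_def)
    moreover have "a k \<le> a (k + r)" using \<open>incseq a\<close> by (simp add: incseqD)
    ultimately show ?thesis by (simp add: algebra_simps)
  qed
  have "a k \<le> b 0" for k using a_le_b[of k] decseqD[OF \<open>decseq b\<close>, of 0 k] by simp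
  then obtain L where L: "a \<longlonglongrightarrow> L"
    using incseq_convergent[OF \<open>incseq a\<close>] by blast
  have "a 0 \<le> b k" for k using a_le_b[of k] incseqD[OF \<open>incseq a\<close>, of 0 k] by simp
  then obtain M where M: "b \<longlonglongrightarrow> M"
    using decseq_convergent[OF \<open>decseq b\<close>] by blast
  have "M - L \<le> (1 - \<delta>) * (M - L)"
  proof (rule LIMSEQ_le)
    show "(\<lambda>k. b (k + r) - a (k + r)) \<longlonglongrightarrow> M - L"
      using L M by (intro tendsto_diff LIMSEQ_ignore_initial_segment)
    show "(\<lambda>k. (1 - \<delta>) * (b k - a k)) \<longlonglongrightarrow> (1 - \<delta>) * (M - L)"
      using L M by (intro tendsto_intros)
  qed (use contract in blast)
  then have "\<delta> * (M - L) \<le> 0" by (simp add: algebra_simps)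
  then have "M \<le> L" using \<delta> by (simp add: mult_le_0_iff)
  moreover have "L \<le> M" using LIMSEQ_le[OF L M] a_le_b by blast
  ultimately have M: "b \<longlonglongrightarrow> L" using M by simp
  show ?thesis
  proof (intro exI allI impI)
    fix \<epsilon> :: real assume "\<epsilon> > 0"
    have "\<forall>\<^sub>F k in sequentially. L - \<epsilon> < a k" "\<forall>\<^sub>F k in sequentially. b k < L + \<epsilon>"
      using order_tendstoD[OF L] order_tendstoD[OF M] \<open>\<epsilon> > 0\<close> by auto
    then show "\<forall>\<^sub>F k in sequentially. \<forall>x\<in>X k. \<bar>g k x - L\<bar> < \<epsilon>"
    proof eventually_elim
      case (elim k)
      show ?case
      proof
        fix x assume "x \<in> X k"
        then show "\<bar>g k x - L\<bar> < \<epsilon>" using g_le[of x k] g_ge[of x k] elim by linarith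
      qed
    qed
  qed
qed

section \<open>Translations and paths in the alcove\<close>

context circle
begin

lemma finite_range_periodic:
  fixes F :: "int vec \<Rightarrow> 'a"
  assumes "\<And>p q. p \<in> carrier_vec n \<Longrightarrow> same_circle_point m p q \<Longrightarrow> F p = F q"
  shows "finite (F ` carrier_vec n)"
proof (rule finite_subset)
  show "F ` carrier_vec n \<subseteq> F ` box n m"
  proof (rule image_subsetI)
    fix p :: "int vec" assume p: "p \<in> carrier_vec n"
    have "F p = F (reduce m p)" using assms[OF p] same_circle_point_sym[OF reduce_same] by blast
    then show "F p \<in> F ` box n m" using reduce_in_box[OF m_pos p] by blast
  qed
qed simp

text \<open>Among translations by multiples of \<open>m\<close>, exactly those that move all
  coordinates equally preserve the alcove.\<close>

definition shift :: "int \<Rightarrow> int vec \<Rightarrow> int vec" where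
  "shift N p = vec n (\<lambda>i. p $ i + N * int m)"

lemma shift_carrier [simp]: "shift N p \<in> carrier_vec n"
  by (simp add: shift_def)

lemma shift_index [simp]: "i < n \<Longrightarrow> shift N p $ i = p $ i + N * int m"
  by (simp add: shift_def)

lemma shift_alcove: "p \<in> W \<Longrightarrow> shift N p \<in> W"
  using n_pos by (auto simp: alcove_def)

lemma shift_same: "p \<in> carrier_vec n \<Longrightarrow> same_circle_point m (shift N p) p"
  by (auto simp: same_circle_point_def cong_def shift_def)

lemma vec_total_shift:
  assumes "p \<in> carrier_vec n"
  shows "vec_total (shift N p) = vec_total p + N * int n * int m"
proof -
  have "vec_total (shift N p) = (\<Sum>i<n. p $ i + N * int m)"
    unfolding vec_total_def carrier_vecD[OF shift_carrier] by simp
  then show ?thesis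
    using carrier_vecD[OF assms] by (simp add: vec_total_def sum.distrib)
qed

lemma alcove_up_step:
  assumes x: "x \<in> W" and i: "i < n"
    and "i > 0 \<Longrightarrow> x $ i + 1 < x $ (i - 1)"
    and "i = 0 \<Longrightarrow> n > 1 \<Longrightarrow> x $ 0 + 1 - int m < x $ (n - 1)"
  shows "x + unit_vec n i \<in> W"
proof -
  have "x + unit_vec n i \<in> carrier_vec n" using alcove_carrier[OF x] by simp
  moreover have "(x + unit_vec n i) $ Suc j < (x + unit_vec n i) $ j" if "Suc j < n" for j
    using x i that assms(3) by (auto simp: alcove_def split: if_splits)
  moreover have "(x + unit_vec n i) $ 0 - int m < (x + unit_vec n i) $ (n - 1)"
    using x i assms(4) m_pos by (cases "n = 1") (auto simp: alcove_def split: if_splits)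
  ultimately show ?thesis by (simp add: alcove_def)
qed

definition alcove_edges :: "int vec rel" where
  "alcove_edges = {(x, y). x \<in> W \<and> y \<in> W \<and> (\<exists>e\<in>standard_steps n. y = x + e)}"

lemma alcove_edges_sym: "(x, y) \<in> alcove_edges \<Longrightarrow> (y, x) \<in> alcove_edges"
proof -
  assume "(x, y) \<in> alcove_edges"
  then obtain e where e: "x \<in> W" "y \<in> W" "e \<in> standard_steps n" "y = x + e"
    by (auto simp: alcove_edges_def)
  then have "x = y + - e"
    using alcove_carrier[OF e(1)] standard_step_carrier[OF e(3)] by (intro eq_vecI) auto
  then show ?thesis using e uminus_standard_step by (auto simp: alcove_edges_def)
qed

lemma V_same: "p \<in> W \<Longrightarrow> q \<in> W \<Longrightarrow> same_circle_point m p q \<Longrightarrow> V p = V q"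
  using abs_V_same[of p q] V_pos[of p] V_pos[of q] alcove_carrier by auto

end

text \<open>For \<open>n = m > 1\<close> every residue is occupied and nothing can move. Otherwise
  some residue is free, or there is a single coordinate, which can move even for
  \<open>m = 1\<close>.\<close>

locale circle_with_room = circle +
  assumes room: "n < m \<or> n = 1"
begin

lemma \<rho>_pos: "\<rho> > 0"
proof (cases "m = 1")
  case False
  then have m: "1 < m" using m_pos by simp
  have "n < m" using room m by auto
  then have "real n * pi / m < pi" "real n * pi / m > 0" "pi / m < pi" "pi / m > 0"
    using n_pos m by (auto simp: field_simps)
  then show ?thesis by (simp add: sine_quotient_def sin_gt_zero)
qed (simp add: sine_quotient_def)

text \<open>If every coordinate that must still be raised were blocked by its predecessor, all
  coordinates would be packed without gaps, forcing \<open>n = m\<close>.\<close>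

lemma exists_up_step:
  assumes x: "x \<in> W" and y: "y \<in> W" and le: "\<And>i. i < n \<Longrightarrow> x $ i \<le> y $ i" and "x \<noteq> y"
  shows "\<exists>i<n. x $ i < y $ i \<and> x + unit_vec n i \<in> W"
proof (rule ccontr)
  assume "\<not> ?thesis"
  then have blocked: "x + unit_vec n i \<notin> W" if "i < n" "x $ i < y $ i" for i
    using that by blast
  \<comment> \<open>A blocked coordinate sits directly below its predecessor; as \<open>y\<close> is
    strictly decreasing, the predecessor must then be raised as well.\<close>
  have pred: "x $ (i - 1) = x $ i + 1 \<and> x $ (i - 1) < y $ (i - 1)" if i: "i < n" "x $ i < y $ i" "i > 0" for i
  proof -
    have "\<not> x $ i + 1 < x $ (i - 1)" using alcove_up_step[OF x i(1)] blocked[OF i(1,2)] i(3) by blast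
    moreover have "x $ i < x $ (i - 1)" "y $ i < y $ (i - 1)" using i alcove_less x y by auto
    ultimately show ?thesis using i by linarith
  qed
  obtain i where i: "i < n" "x $ i < y $ i"
  proof -
    have "\<not> (\<forall>i<n. x $ i = y $ i)"
      using \<open>x \<noteq> y\<close> alcove_carrier[OF x] alcove_carrier[OF y] by (metis carrier_vecD eq_vecI)
    then show ?thesis using that le by (meson order_le_less)
  qed
  have zero: "x $ 0 < y $ 0" using i
  proof (induction i)
    case (Suc i)
    then show ?case using pred[of "Suc i"] by simp
  qed
  have n1: "n > 1"
    using blocked[of 0] zero alcove_up_step[OF x, of 0] n_pos by (cases "n > 1") auto
  have "\<not> x $ 0 + 1 - int m < x $ (n - 1)"
    using blocked[of 0] zero alcove_up_step[OF x, of 0] n_pos by auto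
  moreover have "x $ 0 - int m < x $ (n - 1)" "y $ 0 - int m < y $ (n - 1)"
    using x y by (auto simp: alcove_def)
  ultimately have last: "x $ 0 + 1 - int m = x $ (n - 1)" "x $ (n - 1) < y $ (n - 1)"
    using zero by linarith+
  \<comment> \<open>Coordinate \<open>0\<close> is blocked by the last one across the wrap-around,
    so the same propagation runs from index \<open>n - 1\<close> down to \<open>0\<close> and makes
    all values consecutive.\<close>
  have "x $ (n - 1 - d) = x $ (n - 1) + int d \<and> x $ (n - 1 - d) < y $ (n - 1 - d)" if "d \<le> n - 1" for d
    using that
  proof (induction d)
    case (Suc d)
    then have "Suc d < n" by simp
    then show ?case using Suc pred[of "n - 1 - d"] by auto
  qed (use last in simp)
  from this[of "n - 1"] have "x $ 0 = x $ (n - 1) + int n - 1" using n_pos by auto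
  then have "n = m" using last by linarith
  then show False using room n1 by simp
qed

text \<open>Each upward step that stays below \<open>y\<close> lowers the missing total by one, and
  \<open>exists_up_step\<close> supplies one as long as \<open>y\<close> is not reached.\<close>

lemma up_path:
  assumes y: "y \<in> W"
  shows "x \<in> W \<Longrightarrow> (\<And>i. i < n \<Longrightarrow> x $ i \<le> y $ i) \<Longrightarrow> vec_total y = vec_total x + int d \<Longrightarrow>
    (x, y) \<in> alcove_edges ^^ d"
proof (induction d arbitrary: x)
  have total: "vec_total z = (\<Sum>i<n. z $ i)" if "z \<in> W" for z
    using carrier_vecD[OF alcove_carrier[OF that]] by (simp add: vec_total_def)
  case 0
  have "x = y"
  proof (rule ccontr)
    assume "x \<noteq> y"
    then obtain i where "i < n" "x $ i < y $ i" using exists_up_step[OF 0(1) y 0(2)] by blast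
    then have "vec_total x < vec_total y"
      unfolding total[OF y] total[OF 0(1)] using 0(2) by (intro sum_strict_mono_ex1) auto
    then show False using 0 by simp
  qed
  then show ?case by simp
next
  case (Suc d)
  have "x \<noteq> y" using Suc.prems by auto
  then obtain i where i: "i < n" "x $ i < y $ i" "x + unit_vec n i \<in> W"
    using exists_up_step[OF Suc.prems(1) y Suc.prems(2)] by blast
  have xc: "x \<in> carrier_vec n" using Suc.prems by (simp add: alcove_carrier)
  have "(x, x + unit_vec n i) \<in> alcove_edges"
    using i Suc.prems(1) unit_vec_in_standard_steps by (auto simp: alcove_edges_def)
  moreover have "(x + unit_vec n i, y) \<in> alcove_edges ^^ d"
  proof (rule Suc.IH[OF i(3)])
    show "(x + unit_vec n i) $ j \<le> y $ j" if "j < n" for j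
      using that i Suc.prems(2)[of j] by auto
    show "vec_total y = vec_total (x + unit_vec n i) + int d"
      using Suc.prems(3) xc i by (simp add: vec_total_add vec_total_unit_vec)
  qed
  ultimately show ?case by (rule relpow_Suc_I2)
qed

lemma exists_neighbour:
  assumes x: "x \<in> W"
  shows "\<exists>z. (x, z) \<in> alcove_edges"
proof -
  \<comment> \<open>The translate of \<open>x\<close> itself is a target above \<open>x\<close> that
    always exists.\<close>
  have "shift 1 x $ 0 \<noteq> x $ 0" using n_pos m_pos by simp
  then have "x \<noteq> shift 1 x" by metis
  then obtain i where "i < n" "x + unit_vec n i \<in> W"
    using exists_up_step[OF x shift_alcove[OF x, of 1]] by auto
  then show ?thesis using x unit_vec_in_standard_steps by (auto simp: alcove_edges_def)
qed

lemma closed_path: "x \<in> W \<Longrightarrow> (x, x) \<in> alcove_edges ^^ (2 * j)"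
proof (induction j)
  case (Suc j)
  obtain z where "(x, z) \<in> alcove_edges" using exists_neighbour[OF Suc.prems] by blast
  then have "(x, x) \<in> alcove_edges ^^ Suc (Suc (2 * j))"
    using Suc alcove_edges_sym by (meson relpow_Suc_I2)
  then show ?case by simp
qed simp

text \<open>\<open>averaging_converges\<close> needs one length for all pairs. A translate of
  \<open>y\<close> well above \<open>x\<close> is reached by upward steps alone; by parity the
  number of remaining steps is even, and they are spent going back and forth at
  \<open>x\<close>.\<close>

lemma uniform_reach:
  assumes x: "x \<in> W" and y: "y \<in> W" and parity: "even (vec_total x + vec_total y)"
  shows "\<exists>y'\<in>W. same_circle_point m y' y \<and> (x, y') \<in> alcove_edges ^^ (4 * n * m)"
proof -
  \<comment> \<open>The first coordinate of \<open>y'\<close> is placed at least \<open>m\<close>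
    and less than \<open>3 * m\<close> above that of \<open>x\<close>. Since the coordinates of an
    alcove point spread over less than \<open>m\<close>, all of \<open>y'\<close> then lies above
    \<open>x\<close>, by at most \<open>4 * m\<close> per coordinate. Multiples of
    \<open>2 * m\<close> keep the parity of the total even if \<open>n * m\<close> is odd.\<close>
  define d where "d = y $ 0 - x $ 0 - int m"
  define y' where "y' = shift (- 2 * (d div (2 * int m))) y"
  have y': "y' \<in> W" by (simp add: y'_def shift_alcove[OF y])
  have total: "vec_total z = (\<Sum>i<n. z $ i)" if "z \<in> W" for z
    using carrier_vecD[OF alcove_carrier[OF that]] by (simp add: vec_total_def)
  have "y' $ 0 = x $ 0 + int m + d mod (2 * int m)"
  proof -
    have "y' $ 0 = y $ 0 - d div (2 * int m) * (2 * int m)"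
      using n_pos by (simp add: y'_def)
    also have "\<dots> = y $ 0 - d + d mod (2 * int m)"
      using div_mult_mod_eq[of d "2 * int m"] by linarith
    finally show ?thesis by (simp add: d_def)
  qed
  moreover have "0 \<le> d mod (2 * int m)" "d mod (2 * int m) < 2 * int m"
    using m_pos by auto
  ultimately have y0: "x $ 0 + int m \<le> y' $ 0" "y' $ 0 < x $ 0 + 3 * int m" by linarith+
  have bounds: "x $ i \<le> y' $ i \<and> y' $ i - x $ i \<le> 4 * int m" if i: "i < n" for i
  proof -
    have "y' $ 0 - y' $ i < int m" "x $ 0 - x $ i < int m" "y' $ i - y' $ 0 \<le> 0" "x $ i - x $ 0 \<le> 0"
      using alcove_gap[OF y', of 0 i] alcove_gap[OF x, of 0 i] alcove_less[OF x, of 0 i]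
        alcove_less[OF y', of 0 i] i by (cases "i = 0"; auto)+
    then show ?thesis using y0 by linarith
  qed
  have diff: "vec_total y' - vec_total x = (\<Sum>i<n. y' $ i - x $ i)"
    by (simp add: total x y' sum_subtractf)
  have "0 \<le> vec_total y' - vec_total x"
    unfolding diff using bounds by (intro sum_nonneg) auto
  then obtain u where u: "vec_total y' = vec_total x + int u"
    by (metis nonneg_int_cases add.commute diff_add_cancel)
  have "vec_total y' - vec_total x \<le> (\<Sum>i<n. 4 * int m)"
    unfolding diff using bounds by (intro sum_mono) auto
  then have "int u \<le> int (4 * n * m)" using u by simp
  then have u_le: "u \<le> 4 * n * m" by linarith
  have "even (vec_total y' + vec_total y)"
    using vec_total_shift[OF alcove_carrier[OF y]] by (simp add: y'_def)
  then have "even (int u)" using parity u by presburger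
  then have "even (4 * n * m - u)" using u_le by simp
  then obtain j where j: "4 * n * m - u = 2 * j" by (elim evenE)
  have "(x, y') \<in> alcove_edges ^^ u"
    using bounds by (intro up_path[OF y' x _ u]) auto
  then have "(x, y') \<in> alcove_edges ^^ (2 * j + u)"
    unfolding relpow_add using closed_path[OF x] by blast
  moreover have "2 * j + u = 4 * n * m" using j u_le by simp
  moreover have "same_circle_point m y' y"
    unfolding y'_def by (rule shift_same[OF alcove_carrier[OF y]])
  ultimately show ?thesis using y' by auto
qed

definition ratio :: "int vec \<Rightarrow> nat \<Rightarrow> int vec \<Rightarrow> real" where
  "ratio l k p = walk_count l k p / (\<rho> ^ k * V p)"

lemma ratio_same:
  "p \<in> W \<Longrightarrow> q \<in> W \<Longrightarrow> same_circle_point m p q \<Longrightarrow> ratio l k p = ratio l k q"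
  unfolding ratio_def using V_same walk_count_same alcove_carrier by metis

lemma alcove_edges_image:
  assumes "x \<in> W"
  shows "{y. (x, y) \<in> alcove_edges} = (+) x ` {e \<in> standard_steps n. x + e \<in> W}"
  using assms by (auto simp: alcove_edges_def)

lemma sum_alcove_edges:
  assumes x: "x \<in> W"
  shows "(\<Sum>y | (x, y) \<in> alcove_edges. F y) = (\<Sum>e | e \<in> standard_steps n \<and> x + e \<in> W. F (x + e))"
proof -
  have "e = e'" if "x + e = x + e'" "e \<in> standard_steps n" "e' \<in> standard_steps n" for e e'
  proof (rule eq_vecI)
    fix i assume "i < dim_vec e'"
    then show "e $ i = e' $ i"
      using arg_cong[OF that(1), of "\<lambda>v. v $ i"] standard_step_carrier[OF that(2)]
        standard_step_carrier[OF that(3)] by auto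
  qed (use standard_step_carrier[OF that(2)] standard_step_carrier[OF that(3)] in auto)
  then have "inj_on ((+) x) {e \<in> standard_steps n. x + e \<in> W}"
    by (auto simp: inj_on_def)
  then show ?thesis unfolding alcove_edges_image[OF x] by (simp add: sum.reindex)
qed

lemma ratio_Suc:
  assumes x: "x \<in> W"
  shows "ratio l (Suc k) x = (\<Sum>y | (x, y) \<in> alcove_edges. V y / (\<rho> * V x) * ratio l k y)"
proof -
  have "ratio l (Suc k) x =
      (\<Sum>e | e \<in> standard_steps n \<and> x + e \<in> W. walk_count l k (x + e) / (\<rho> ^ Suc k * V x))"
    by (simp add: ratio_def walk_count_step_sum[OF x] sum_divide_distrib)
  also have "\<dots> = (\<Sum>e | e \<in> standard_steps n \<and> x + e \<in> W. V (x + e) / (\<rho> * V x) * ratio l k (x + e))"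
  proof (intro sum.cong refl)
    fix e assume "e \<in> {e. e \<in> standard_steps n \<and> x + e \<in> W}"
    then have "V (x + e) > 0" by (intro V_pos) auto
    then show "walk_count l k (x + e) / (\<rho> ^ Suc k * V x) = V (x + e) / (\<rho> * V x) * ratio l k (x + e)"
      using \<rho>_pos V_pos[OF x] by (simp add: ratio_def field_simps)
  qed
  finally show ?thesis by (simp add: sum_alcove_edges[OF x])
qed

lemma ratio_converges:
  fixes c :: int
  shows "\<exists>L. \<forall>\<epsilon>>0. \<forall>\<^sub>F k in sequentially.
    \<forall>x\<in>{x \<in> W. even (vec_total x + int k + c)}. \<bar>ratio l k x - L\<bar> < \<epsilon>"
proof -
  \<comment> \<open>\<open>V\<close> has finitely many values on the alcove, so the transition
    weights have a positive lower bound; inserting \<open>1\<close> ensures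
    \<open>w0 \<le> 1\<close>.\<close>
  define w0 where "w0 = Min (insert 1 ((\<lambda>(a, b). a / (\<rho> * b)) ` (V ` W \<times> V ` W)))"
  have fin_V: "finite (V ` W)"
  proof (rule finite_subset)
    show "V ` W \<subseteq> (\<lambda>p. \<bar>V p\<bar>) ` carrier_vec n"
      using V_pos alcove_carrier by (force simp: image_iff)
    show "finite ((\<lambda>p. \<bar>V p\<bar>) ` carrier_vec n)"
      by (rule finite_range_periodic) (rule abs_V_same)
  qed
  have fin_C: "finite (walk_count l k ` W)" for k
  proof (rule finite_subset)
    show "walk_count l k ` W \<subseteq> walk_count l k ` carrier_vec n"
      using alcove_carrier by blast
    show "finite (walk_count l k ` carrier_vec n)"
      by (rule finite_range_periodic) (rule walk_count_same)
  qed
  have fin_w: "finite (insert 1 ((\<lambda>(a, b). a / (\<rho> * b)) ` (V ` W \<times> V ` W)))"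
    using fin_V by simp
  have "0 < w0"
    unfolding w0_def using fin_w \<rho>_pos V_pos by (subst Min_gr_iff) auto
  have w0_le: "w0 \<le> V y / (\<rho> * V x)" if "x \<in> W" "y \<in> W" for x y
    unfolding w0_def using that by (intro Min_le[OF fin_w]) (auto simp: image_iff intro!: bexI[of _ "(V y, V x)"])
  show ?thesis
  proof (rule averaging_converges[where N = "\<lambda>x. {y. (x, y) \<in> alcove_edges}"
        and w = "\<lambda>x y. V y / (\<rho> * V x)" and ?w0.0 = w0 and r = "4 * n * m"])
    fix k x y assume x: "x \<in> {x \<in> W. even (vec_total x + int (Suc k) + c)}"
      and y: "y \<in> {y. (x, y) \<in> alcove_edges}"
    then obtain e where e: "y \<in> W" "e \<in> standard_steps n" "y = x + e"
      by (auto simp: alcove_edges_def)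
    have "even (vec_total y) \<longleftrightarrow> odd (vec_total x)"
      unfolding e(3) using x by (intro odd_vec_total_add_step[OF _ e(2)] alcove_carrier) auto
    then show "y \<in> {x \<in> W. even (vec_total x + int k + c)}" using x e(1) by auto
  next
    fix k x assume "x \<in> {x \<in> W. even (vec_total x + int k + c)}"
    then have x: "x \<in> W" by simp
    show "finite {y. (x, y) \<in> alcove_edges}"
      unfolding alcove_edges_image[OF x] by simp
    show "(\<Sum>y\<in>{y. (x, y) \<in> alcove_edges}. V y / (\<rho> * V x)) = 1"
      using V_alcove_step_sum[OF x] V_pos[OF x] \<rho>_pos
      by (simp add: sum_alcove_edges[OF x] sum_divide_distrib[symmetric])
    show "w0 \<le> V y / (\<rho> * V x)" if "y \<in> {y. (x, y) \<in> alcove_edges}" for y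
      using that x by (intro w0_le) (auto simp: alcove_edges_def)
  next
    show "0 < w0" by fact
    show "w0 \<le> 1" unfolding w0_def by (intro Min_le fin_w) simp
  next
    fix k x assume "x \<in> {x \<in> W. even (vec_total x + int (Suc k) + c)}"
    then show "ratio l (Suc k) x = (\<Sum>y\<in>{y. (x, y) \<in> alcove_edges}. V y / (\<rho> * V x) * ratio l k y)"
      by (intro ratio_Suc) simp
  next
    fix k
    have "ratio l k ` W \<subseteq> (\<lambda>(a, b). a / (\<rho> ^ k * b)) ` (walk_count l k ` W \<times> V ` W)"
      by (auto simp: ratio_def image_iff)
    then have "finite (ratio l k ` W)"
      by (rule finite_subset) (use fin_V fin_C in simp)
    then show "finite (ratio l k ` {x \<in> W. even (vec_total x + int k + c)})"
      by (rule finite_subset[rotated]) auto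
  next
    fix k
    \<comment> \<open>The tightly packed point lies in the alcove because \<open>n \<le> m\<close>;
      it or one of its neighbours has the required parity.\<close>
    define x where "x = vec n (\<lambda>i. - int i)"
    have x: "x \<in> W" using n_pos n_le_m by (auto simp: alcove_def x_def)
    obtain z where z: "(x, z) \<in> alcove_edges" using exists_neighbour[OF x] by blast
    then have "even (vec_total z) \<longleftrightarrow> odd (vec_total x)"
      using odd_vec_total_add_step[OF alcove_carrier[OF x]] by (auto simp: alcove_edges_def)
    moreover have "z \<in> W" using z by (simp add: alcove_edges_def)
    ultimately have "x \<in> {x \<in> W. even (vec_total x + int k + c)} \<or> z \<in> {x \<in> W. even (vec_total x + int k + c)}"
      using x by auto
    then show "{x \<in> W. even (vec_total x + int k + c)} \<noteq> {}" by blast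
  next
    fix k x y
    assume x: "x \<in> {x \<in> W. even (vec_total x + int (k + 4 * n * m) + c)}"
      and y: "y \<in> {x \<in> W. even (vec_total x + int k + c)}"
    have "even (vec_total x + vec_total y)" using x y by auto
    then obtain y' where y': "y' \<in> W" "same_circle_point m y' y" "(x, y') \<in> alcove_edges ^^ (4 * n * m)"
      using uniform_reach x y by blast
    have "{(x, y). y \<in> {y. (x, y) \<in> alcove_edges}} = alcove_edges" by auto
    then show "\<exists>y'. ratio l k y' = ratio l k y \<and>
        (x, y') \<in> {(x, y). y \<in> {y. (x, y) \<in> alcove_edges}} ^^ (4 * n * m)"
      using y' y ratio_same[OF y'(1) _ y'(2)] by (intro exI[of _ y']) simp
  qed
qed

end

subsection \<open>The norm of the eigenfunction\<close>

text \<open>The list form of the order condition on the end point of the walks; it characterises the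
  box points that lift to the alcove.\<close>

definition decreasing_rotation :: "'a::linorder list \<Rightarrow> bool" where
  "decreasing_rotation xs \<longleftrightarrow> (\<exists>s\<le>length xs. sorted_wrt (>) (drop s xs @ take s xs))"

lemma drop_take_eq_rotate: "s \<le> length xs \<Longrightarrow> drop s xs @ take s xs = rotate s xs"
  by (cases "s = length xs") (simp_all add: rotate_drop_take)

lemma decreasing_rotation_iff_rotate:
  "decreasing_rotation xs \<longleftrightarrow> (\<exists>s\<le>length xs. sorted_wrt (>) (rotate s xs))"
  unfolding decreasing_rotation_def by (rule ex_cong1) (simp add: drop_take_eq_rotate cong: conj_cong)

lemma sorted_wrt_map_upt:
  "sorted_wrt P (map f [a..<b]) \<longleftrightarrow> (\<forall>i j. a \<le> i \<and> i < j \<and> j < b \<longrightarrow> P (f i) (f j))"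
proof
  assume *: "sorted_wrt P (map f [a..<b])"
  show "\<forall>i j. a \<le> i \<and> i < j \<and> j < b \<longrightarrow> P (f i) (f j)"
  proof (intro allI impI)
    fix i j assume "a \<le> i \<and> i < j \<and> j < b"
    then show "P (f i) (f j)"
      using *[unfolded sorted_wrt_iff_nth_less, rule_format, of "i - a" "j - a"] by auto
  qed
qed (auto simp: sorted_wrt_iff_nth_less)

text \<open>A finite set has one decreasing list, and the rotations of that list are told apart by
  their first entries. This is the origin of the factor \<open>n\<close> beside \<open>m ^ n\<close>
  in the constant.\<close>

lemma card_decreasing_rotations:
  fixes A :: "'a::linorder set"
  assumes fin: "finite A" and "A \<noteq> {}"
  shows "card {xs. set xs = A \<and> decreasing_rotation xs} = card A"
proof -
  define ys where "ys = rev (sorted_list_of_set A)"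
  have ys: "set ys = A" "length ys = card A" "distinct ys" "sorted_wrt (>) ys"
    using fin by (auto simp: ys_def sorted_wrt_rev)
  have unique: "zs = ys" if "sorted_wrt (>) zs" "set zs = A" for zs
  proof -
    have "rev zs = rev ys"
      using that ys(1,4) by (intro strict_sorted_equal) (simp_all add: sorted_wrt_rev)
    then show ?thesis by simp
  qed
  have "{xs. set xs = A \<and> decreasing_rotation xs} = (\<lambda>s. rotate s ys) ` {..<card A}"
  proof (intro equalityI subsetI)
    fix xs assume "xs \<in> {xs. set xs = A \<and> decreasing_rotation xs}"
    then obtain s where s: "set xs = A" "s \<le> length xs" "sorted_wrt (>) (rotate s xs)"
      by (auto simp: decreasing_rotation_iff_rotate)
    have "rotate s xs = ys" using s by (intro unique) auto
    then have "xs = rotate (length xs - s) ys"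
      using s(2) by (auto simp: rotate_rotate)
    then have "xs = rotate ((length xs - s) mod card A) ys"
      using rotate_conv_mod ys(2) by metis
    moreover have "card A > 0" using assms by (simp add: card_gt_0_iff)
    ultimately show "xs \<in> (\<lambda>s. rotate s ys) ` {..<card A}" by force
  next
    fix xs assume "xs \<in> (\<lambda>s. rotate s ys) ` {..<card A}"
    then obtain s where s: "s < card A" "xs = rotate s ys" by auto
    have len: "length xs = card A" using s ys by simp
    have "drop (card A - s) xs @ take (card A - s) xs = rotate (card A - s) xs"
      using len by (intro drop_take_eq_rotate) simp
    also have "\<dots> = ys" using s ys(2) by (simp add: rotate_rotate)
    finally have "decreasing_rotation xs"
      using ys(4) len unfolding decreasing_rotation_def
      by (intro exI[of _ "card A - s"]) simp
    then show "xs \<in> {xs. set xs = A \<and> decreasing_rotation xs}" using s ys(1) by simp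
  qed
  moreover have "inj_on (\<lambda>s. rotate s ys) {..<card A}"
  proof (rule inj_onI)
    fix s t assume st: "s \<in> {..<card A}" "t \<in> {..<card A}" "rotate s ys = rotate t ys"
    then have "rotate s ys ! 0 = rotate t ys ! 0" by simp
    then have "ys ! s = ys ! t" using st ys(2) by (subst (asm) (1 2) nth_rotate) auto
    then show "s = t" using st ys by (simp add: nth_eq_iff_index_eq)
  qed
  ultimately show ?thesis by (simp add: card_image)
qed

lemma prod_off_diagonal:
  fixes f :: "nat \<Rightarrow> nat \<Rightarrow> 'a::comm_monoid_mult"
  assumes "\<And>h t. f h t = f t h"
  shows "(\<Prod>t<n. \<Prod>h\<in>{..<n} - {t}. f h t) = (\<Prod>t<n. \<Prod>h<t. f h t)\<^sup>2"
proof (induction n)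
  case (Suc n)
  have "(\<Prod>h\<in>{..<Suc n} - {t}. f h t) = f n t * (\<Prod>h\<in>{..<n} - {t}. f h t)" if "t < n" for t
  proof -
    have "{..<Suc n} - {t} = insert n ({..<n} - {t})" using that by auto
    then show ?thesis by simp
  qed
  moreover have "{..<Suc n} - {n} = {..<n}" by auto
  ultimately have "(\<Prod>t<Suc n. \<Prod>h\<in>{..<Suc n} - {t}. f h t) =
      (\<Prod>t<n. f n t) * (\<Prod>t<n. \<Prod>h\<in>{..<n} - {t}. f h t) * (\<Prod>h<n. f h n)"
    by (simp add: prod.distrib)
  also have "\<dots> = (\<Prod>h<n. f h n)\<^sup>2 * (\<Prod>t<n. \<Prod>h<t. f h t)\<^sup>2"
    using assms[of n] by (simp add: Suc power2_eq_square mult_ac)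
  finally show ?case by (simp add: power_mult_distrib mult.commute)
qed simp

section \<open>Orthogonality and the share of the alcove in the norm\<close>

context circle
begin

text \<open>A character times a conjugate one has a frequency that is an integer multiple of
  \<open>2 * pi / m\<close>, with multiplier less than \<open>m\<close> in absolute value because
  \<open>n \<le> m\<close>. So orthogonality holds even for even \<open>n\<close>, where single
  characters are not periodic, and only pairs of equal permutations survive.\<close>

lemma slater_norm_sum: "(\<Sum>x\<in>box n m. slater x * cnj (slater x)) = fact n * of_nat m ^ n"
proof -
  define \<alpha> where "\<alpha> j = pi * (2 * real j - (real n - 1)) / real m" for j
  have fin: "finite {\<sigma>. \<sigma> permutes {..<n}}" by (rule finite_permutations) simp
  have char_sum: "(\<Sum>y<m. cis (\<alpha> i * real y) * cis (- (\<alpha> j * real y))) = (if i = j then of_nat m else 0)"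
    if "i < n" "j < n" for i j
  proof -
    have "cis (\<alpha> i * real y) * cis (- (\<alpha> j * real y)) = cis (2 * pi * of_int (int i - int j) * real y / real m)" for y
    proof -
      have "\<alpha> i * real y + - (\<alpha> j * real y) = 2 * pi * of_int (int i - int j) * real y / real m"
        using m_pos by (simp add: \<alpha>_def field_simps)
      then show ?thesis by (simp add: cis_mult)
    qed
    moreover have "\<bar>int i - int j\<bar> < int m" using that n_le_m by linarith
    ultimately show ?thesis using sum_cis_root_of_unity[OF m_pos, of "int i - int j"] by simp
  qed
  have "(\<Sum>x\<in>box n m. slater x * cnj (slater x)) =
    (\<Sum>x\<in>box n m. \<Sum>\<sigma> | \<sigma> permutes {..<n}. \<Sum>\<tau> | \<tau> permutes {..<n}. signof \<sigma> * signof \<tau> *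
      (\<Prod>h<n. cis (\<alpha> (\<sigma> h) * of_int (x $ h)) * cis (- (\<alpha> (\<tau> h) * of_int (x $ h)))))"
    unfolding slater_def \<alpha>_def[symmetric] cnj_sum sum_product
    by (intro sum.cong refl) (simp add: prod.distrib cis_cnj mult_ac)
  also have "\<dots> = (\<Sum>\<sigma> | \<sigma> permutes {..<n}. \<Sum>\<tau> | \<tau> permutes {..<n}. signof \<sigma> * signof \<tau> *
      (\<Sum>x\<in>box n m. \<Prod>h<n. cis (\<alpha> (\<sigma> h) * of_int (x $ h)) * cis (- (\<alpha> (\<tau> h) * of_int (x $ h)))))"
    by (subst sum.swap, intro sum.cong[OF refl], subst sum.swap) (simp add: sum_distrib_left)
  also have "\<dots> = (\<Sum>\<sigma> | \<sigma> permutes {..<n}. \<Sum>\<tau> | \<tau> permutes {..<n}. if \<tau> = \<sigma> then of_nat m ^ n else 0)"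
  proof (intro sum.cong refl, clarify)
    fix \<sigma> \<tau> assume \<sigma>: "\<sigma> permutes {..<n}" and \<tau>: "\<tau> permutes {..<n}"
    have "(\<Sum>x\<in>box n m. \<Prod>h<n. cis (\<alpha> (\<sigma> h) * of_int (x $ h)) * cis (- (\<alpha> (\<tau> h) * of_int (x $ h)))) =
        (\<Prod>h<n. \<Sum>y<m. cis (\<alpha> (\<sigma> h) * real y) * cis (- (\<alpha> (\<tau> h) * real y)))"
      by (subst sum_box_prod[where f = "\<lambda>h y. cis (\<alpha> (\<sigma> h) * of_int y) * cis (- (\<alpha> (\<tau> h) * of_int y))"]) simp
    also have "\<dots> = (\<Prod>h<n. if \<sigma> h = \<tau> h then of_nat m else 0)"
      using permutes_in_image[OF \<sigma>] permutes_in_image[OF \<tau>]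
      by (intro prod.cong refl char_sum) auto
    also have "\<dots> = (if \<tau> = \<sigma> then of_nat m ^ n else 0)"
    proof (cases "\<tau> = \<sigma>")
      case False
      then obtain h where "\<sigma> h \<noteq> \<tau> h" by force
      moreover from this have "h < n" using permutes_not_in[OF \<sigma>] permutes_not_in[OF \<tau>] by force
      ultimately show ?thesis using False by (auto intro!: prod_zero)
    qed simp
    finally show "signof \<sigma> * signof \<tau> * (\<Sum>x\<in>box n m. \<Prod>h<n. cis (\<alpha> (\<sigma> h) * of_int (x $ h)) * cis (- (\<alpha> (\<tau> h) * of_int (x $ h)))) =
        (if \<tau> = \<sigma> then of_nat m ^ n else 0 :: complex)"
      by (simp add: sign_def)
  qed
  also have "\<dots> = (\<Sum>\<sigma> | \<sigma> permutes {..<n}. of_nat m ^ n)"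
    using fin by (intro sum.cong refl) (simp add: sum.delta')
  also have "\<dots> = fact n * of_nat m ^ n"
    using card_permutations[of "{..<n}" n] by simp
  finally show ?thesis .
qed

lemma V_square_sum_box: "2 ^ (n\<^sup>2 - n) * (\<Sum>x\<in>box n m. (V x)\<^sup>2) = fact n * real m ^ n"
proof -
  define \<kappa> where "\<kappa> = (\<Prod>t<n. \<Prod>h<t. - 2 * \<i>)"
  have "cmod \<kappa> = (\<Prod>t<n. \<Prod>h<t. 2)"
    by (simp add: \<kappa>_def prod_norm[symmetric] norm_mult norm_power)
  then have \<kappa>: "\<kappa> * cnj \<kappa> = 2 ^ (n\<^sup>2 - n)"
    unfolding complex_norm_square[symmetric] by (simp only: prod_const_pairs) simp
  have "(\<Sum>x\<in>box n m. slater x * cnj (slater x)) = of_real (2 ^ (n\<^sup>2 - n) * (\<Sum>x\<in>box n m. (V x)\<^sup>2))"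
  proof -
    have "slater x * cnj (slater x) = of_real (2 ^ (n\<^sup>2 - n) * (V x)\<^sup>2)" for x
    proof -
      have "slater x * cnj (slater x) = (\<kappa> * cnj \<kappa>) * of_real (V x * V x)"
        unfolding slater_eq \<kappa>_def[symmetric] by simp
      then show ?thesis unfolding \<kappa> by (simp add: power2_eq_square)
    qed
    then show ?thesis by (simp add: sum_distrib_left)
  qed
  then have "complex_of_real (2 ^ (n\<^sup>2 - n) * (\<Sum>x\<in>box n m. (V x)\<^sup>2)) = of_real (fact n * real m ^ n)"
    using slater_norm_sum by simp
  then show ?thesis unfolding of_real_eq_iff .
qed

lemma sorted_rotation_iff:
  assumes x: "x \<in> carrier_vec n" and s: "s \<le> n"
  shows "sorted_wrt (>) (drop s (list_of_vec x) @ take s (list_of_vec x)) \<longleftrightarrow>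
    (\<forall>i j. i < j \<and> j < s \<longrightarrow> x $ j < x $ i) \<and>
    (\<forall>i j. s \<le> i \<and> i < j \<and> j < n \<longrightarrow> x $ j < x $ i) \<and>
    (\<forall>i j. i < s \<and> s \<le> j \<and> j < n \<longrightarrow> x $ i < x $ j)"
proof -
  have "take s (list_of_vec x) = map (($) x) [0..<s]" "drop s (list_of_vec x) = map (($) x) [s..<n]"
    using carrier_vecD[OF x] s by (simp_all add: list_of_vec_map drop_map take_map take_upt)
  then show ?thesis by (auto simp: sorted_wrt_append sorted_wrt_map_upt)
qed

text \<open>For an end point as in the theorem this undoes the rotation and gives an alcove point;
  it is the origin of the term \<open>s * m\<close> in the parity condition.\<close>

definition lift :: "nat \<Rightarrow> int vec \<Rightarrow> int vec" where
  "lift s x = vec n (\<lambda>i. x $ i + (if i < s then int m else 0))"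

lemma lift_alcove:
  assumes x: "x \<in> box n m" and s: "s \<le> n"
    and sorted: "sorted_wrt (>) (drop s (list_of_vec x) @ take s (list_of_vec x))"
  shows "lift s x \<in> W"
proof -
  have b: "0 \<le> x $ i" "x $ i < int m" if "i < n" for i using x that by (auto simp: box_def)
  have "i < j \<Longrightarrow> j < s \<Longrightarrow> x $ j < x $ i"
    and "s \<le> i \<Longrightarrow> i < j \<Longrightarrow> j < n \<Longrightarrow> x $ j < x $ i"
    and "i < s \<Longrightarrow> s \<le> j \<Longrightarrow> j < n \<Longrightarrow> x $ i < x $ j"
    for i j
    using sorted_rotation_iff[OF box_carrier[OF x] s] sorted by blast+
  note this[of _ "Suc _"] this[of 0 "n - 1"]
  moreover have "x $ Suc i < x $ i + int m" if "Suc i < n" for i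
    using b[of i] b[of "Suc i"] that by auto
  moreover have "x $ 0 - int m < x $ (n - 1)" using b[of 0] b[of "n - 1"] n_pos by auto
  ultimately show ?thesis using n_pos by (auto simp: alcove_def lift_def)
qed

lemma lift_same: "x \<in> carrier_vec n \<Longrightarrow> same_circle_point m (lift s x) x"
  by (auto simp: same_circle_point_def cong_def lift_def)

lemma vec_total_lift:
  assumes "x \<in> carrier_vec n" "s \<le> n"
  shows "vec_total (lift s x) = vec_total x + int s * int m"
proof -
  have "vec_total (lift s x) = (\<Sum>i<n. x $ i) + (\<Sum>i<n. if i < s then int m else 0)"
    by (simp add: vec_total_def lift_def sum.distrib)
  also have "(\<Sum>i<n. if i < s then int m else 0) = (\<Sum>i<s. int m)"
    using assms(2) by (intro sum.mono_neutral_cong_right) auto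
  finally show ?thesis using assms(1) by (simp add: vec_total_def carrier_vecD)
qed

lemma box_alcove_iff:
  assumes x: "x \<in> box n m"
  shows "(\<exists>q\<in>W. same_circle_point m q x) \<longleftrightarrow> decreasing_rotation (list_of_vec x)"
proof
  assume "decreasing_rotation (list_of_vec x)"
  then show "\<exists>q\<in>W. same_circle_point m q x"
    using lift_alcove[OF x] lift_same[OF box_carrier[OF x]] carrier_vecD[OF box_carrier[OF x]]
    by (auto simp: decreasing_rotation_def)
next
  assume "\<exists>q\<in>W. same_circle_point m q x"
  then obtain q where q: "q \<in> W" "same_circle_point m q x" by blast
  \<comment> \<open>\<open>k\<close> numbers the period of length \<open>m\<close> that contains the
    largest coordinate, and \<open>s\<close> counts the coordinates in that period. The others lie
    in the period below, so reduction to the box puts them above the first \<open>s\<close>.\<close>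
  define k where "k = q $ 0 div int m"
  define s where "s = (LEAST i. i = n \<or> q $ i < k * int m)"
  have s: "s = n \<or> q $ s < k * int m" "s \<le> n"
    unfolding s_def by (rule LeastI[of _ n], simp) (rule Least_le, simp)
  have q0: "k * int m \<le> q $ 0" "q $ 0 < k * int m + int m"
    using m_pos div_mult_mod_eq[of "q $ 0" "int m"] pos_mod_bound[of "int m" "q $ 0"]
      pos_mod_sign[of "int m" "q $ 0"] unfolding k_def by linarith+
  have less: "q $ j < q $ i" if "i < j" "j < n" for i j using alcove_less[OF q(1) that] .
  have gap: "q $ 0 - q $ i < int m" if "i < n" for i using alcove_gap[OF q(1)] that n_pos by simp
  have le0: "q $ i \<le> q $ 0" if "i < n" for i using less[of 0 i] that by (cases "i = 0") auto
  have low: "k * int m \<le> q $ i" if "i < s" for i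
    using not_less_Least[of i "\<lambda>i. i = n \<or> q $ i < k * int m"] that by (auto simp: s_def)
  have high: "q $ i < k * int m" if "s \<le> i" "i < n" for i
    using s less[of s i] that by (cases "i = s") auto
  have val: "x $ i = q $ i - k * int m + (if i < s then 0 else int m)" if i: "i < n" for i
  proof (rule ccontr)
    let ?v = "q $ i - k * int m + (if i < s then 0 else int m)"
    assume neq: "x $ i \<noteq> ?v"
    have "0 \<le> x $ i" "x $ i < int m" using x i by (auto simp: box_def)
    moreover have "0 \<le> ?v" "?v < int m"
      using low[of i] high[of i] gap[OF i] le0[OF i] q0 i by (auto simp: not_less)
    ultimately have "\<bar>x $ i - ?v\<bar> < int m" by linarith
    then have "\<not> [x $ i = ?v] (mod int m)" using neq by (rule small_not_cong[rotated])
    moreover have "[q $ i = x $ i] (mod int m)"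
      using q(2) i carrier_vecD[OF alcove_carrier[OF q(1)]] by (simp add: same_circle_point_def)
    moreover have "[q $ i = ?v] (mod int m)" by (auto simp: cong_iff_dvd_diff)
    ultimately show False by (simp add: cong_def)
  qed
  have "sorted_wrt (>) (drop s (list_of_vec x) @ take s (list_of_vec x))"
    unfolding sorted_rotation_iff[OF box_carrier[OF x] s(2)]
  proof (intro conjI allI impI; (elim conjE)?)
    fix i j assume "i < j" "j < s"
    then show "x $ j < x $ i" using val[of i] val[of j] less[of i j] s(2) by simp
  next
    fix i j assume "s \<le> i" "i < j" "j < n"
    then show "x $ j < x $ i" using val[of i] val[of j] less[of i j] by simp
  next
    fix i j assume "i < s" "s \<le> j" "j < n"
    then show "x $ i < x $ j" using val[of i] val[of j] le0[of i] gap[of j] by simp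
  qed
  then show "decreasing_rotation (list_of_vec x)"
    using s(2) carrier_vecD[OF box_carrier[OF x]] by (auto simp: decreasing_rotation_def)
qed

text \<open>Squaring turns the product over pairs into one over ordered pairs of different entries,
  which no longer depends on their arrangement.\<close>

lemma V_square_eq_set:
  assumes x: "x \<in> box n m" and d: "distinct (list_of_vec x)"
  shows "(V x)\<^sup>2 = (\<Prod>a\<in>set (list_of_vec x). \<Prod>b\<in>set (list_of_vec x) - {a}. \<bar>sin (pi * of_int (b - a) / real m)\<bar>)"
proof -
  define f where "f a b = \<bar>sin (pi * real_of_int (b - a) / real m)\<bar>" for a b
  have f_sym: "f a b = f b a" for a b
  proof -
    have "pi * real_of_int (b - a) / real m = - (pi * real_of_int (a - b) / real m)"
      by (simp add: diff_divide_distrib right_diff_distrib)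
    then show ?thesis unfolding f_def by (simp only: sin_minus abs_minus_cancel)
  qed
  have set_x: "set (list_of_vec x) = ($) x ` {..<n}"
    using carrier_vecD[OF box_carrier[OF x]] by (auto simp: list_of_vec_map)
  have inj: "inj_on (($) x) {..<n}"
    using d carrier_vecD[OF box_carrier[OF x]] by (simp add: list_of_vec_map distinct_map atLeast0LessThan)
  have "(\<Prod>a\<in>set (list_of_vec x). \<Prod>b\<in>set (list_of_vec x) - {a}. f a b) =
      (\<Prod>t<n. \<Prod>b\<in>($) x ` {..<n} - {x $ t}. f (x $ t) b)"
    unfolding set_x by (simp add: prod.reindex[OF inj])
  also have "\<dots> = (\<Prod>t<n. \<Prod>h\<in>{..<n} - {t}. f (x $ t) (x $ h))"
  proof (intro prod.cong refl)
    fix t assume t: "t \<in> {..<n}"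
    have "($) x ` {..<n} - {x $ t} = ($) x ` ({..<n} - {t})"
      using inj t by (auto simp: inj_on_def)
    then show "(\<Prod>b\<in>($) x ` {..<n} - {x $ t}. f (x $ t) b) = (\<Prod>h\<in>{..<n} - {t}. f (x $ t) (x $ h))"
      using prod.reindex[OF inj_on_subset[OF inj], of "{..<n} - {t}" "f (x $ t)"] by auto
  qed
  also have "\<dots> = (\<Prod>t<n. \<Prod>h<t. f (x $ t) (x $ h))\<^sup>2"
    by (rule prod_off_diagonal) (rule f_sym)
  also have "\<dots> = \<bar>V x\<bar>\<^sup>2"
    by (simp add: f_def sine_vandermonde_eq_prod abs_prod)
  finally show ?thesis by (simp add: f_def)
qed

lemma distinct_list_iff:
  assumes x: "x \<in> box n m"
  shows "distinct (list_of_vec x) \<longleftrightarrow> x \<in> distinct_points n m"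
proof -
  have "[x $ i = x $ j] (mod int m) \<longleftrightarrow> x $ i = x $ j" if "i < n" "j < n" for i j
    using x that by (auto simp: box_def cong_def)
  then show ?thesis
    using box_carrier[OF x] by (auto simp: distinct_points_def distinct_conv_nth list_of_vec_index)
qed

text \<open>Distinctness turns the cardinality \<open>n\<close> of the set into the length
  \<open>n\<close> of the list, so that lists and box points correspond.\<close>

lemma card_box_lists:
  assumes A: "A \<subseteq> {0..<int m}" "card A = n" and P: "\<And>xs. P xs \<Longrightarrow> distinct xs"
  shows "card {x \<in> box n m. P (list_of_vec x) \<and> set (list_of_vec x) = A} = card {xs. set xs = A \<and> P xs}"
proof (rule bij_betw_same_card[of list_of_vec], rule bij_betw_byWitness[where f' = vec_of_list])
  show "vec_of_list ` {xs. set xs = A \<and> P xs} \<subseteq>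
      {x \<in> box n m. P (list_of_vec x) \<and> set (list_of_vec x) = A}"
  proof (rule image_subsetI)
    fix xs assume xs: "xs \<in> {xs. set xs = A \<and> P xs}"
    then have len: "length xs = n" using P A(2) distinct_card[of xs] by auto
    have "xs ! i \<in> {0..<int m}" if "i < n" for i
      using xs that len A(1) nth_mem[of i xs] by auto
    moreover have "vec_of_list xs \<in> carrier_vec n" using len by (intro carrier_vecI) simp
    ultimately have "vec_of_list xs \<in> box n m" by (simp add: box_def vec_of_list_index)
    then show "vec_of_list xs \<in> {x \<in> box n m. P (list_of_vec x) \<and> set (list_of_vec x) = A}"
      using xs by (simp add: list_vec)
  qed
  show "list_of_vec ` {x \<in> box n m. P (list_of_vec x) \<and> set (list_of_vec x) = A} \<subseteq>
      {xs. set xs = A \<and> P xs}"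
    by blast
qed (simp_all add: list_vec vec_list)

lemma decreasing_rotation_distinct: "decreasing_rotation xs \<Longrightarrow> distinct xs"
  for xs :: "int list"
proof -
  assume "decreasing_rotation xs"
  then obtain s where "s \<le> length xs" "sorted_wrt (>) (rotate s xs)"
    by (auto simp: decreasing_rotation_iff_rotate)
  then have "sorted_wrt (<) (rev (rotate s xs))" by (simp add: sorted_wrt_rev)
  then show ?thesis by (simp add: strict_sorted_iff)
qed

text \<open>By \<open>box_alcove_iff\<close> and \<open>alcove_same_shift\<close>, one
  representative for each class of alcove points under common translation by multiples of
  \<open>m\<close>.\<close>

abbreviation "alcove_box \<equiv> {x \<in> box n m. decreasing_rotation (list_of_vec x)}"

text \<open>The value of \<open>V\<^sup>2\<close> depends only on the set of occupied sites; each such set is the support of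
  \<open>n!\<close> points of the box, of which \<open>n\<close> come from the alcove.\<close>

lemma V_square_sum: "2 ^ (n\<^sup>2 - n) * (\<Sum>x\<in>alcove_box. (V x)\<^sup>2) = real n * real m ^ n"
proof -
  define T where "T = {A. A \<subseteq> {0..<int m} \<and> card A = n}"
  define F where "F A = (\<Prod>a\<in>A. \<Prod>b\<in>A - {a}. \<bar>sin (pi * real_of_int (b - a) / real m)\<bar>)" for A
  have fin_T: "finite T" unfolding T_def by (rule finite_subset[of _ "Pow {0..<int m}"]) auto
  \<comment> \<open>Used for two choices of \<open>P\<close>: distinct lists give \<open>n!\<close>
    points for each set of sites, decreasing rotations give \<open>n\<close>. The norm over the
    whole box is known, so the alcove part follows by proportion.\<close>
  have by_support: "(\<Sum>x | x \<in> box n m \<and> P (list_of_vec x). (V x)\<^sup>2) =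
      (\<Sum>A\<in>T. real (card {xs. set xs = A \<and> P xs}) * F A)"
    if P: "\<And>xs. P xs \<Longrightarrow> distinct xs" for P
  proof -
    have "(\<Sum>x | x \<in> box n m \<and> P (list_of_vec x). (V x)\<^sup>2) =
        (\<Sum>A\<in>T. \<Sum>x | x \<in> {x. x \<in> box n m \<and> P (list_of_vec x)} \<and> set (list_of_vec x) = A. (V x)\<^sup>2)"
    proof (rule sum.group[symmetric])
      show "(\<lambda>x. set (list_of_vec x)) ` {x. x \<in> box n m \<and> P (list_of_vec x)} \<subseteq> T"
        unfolding T_def
        using P by (auto simp: distinct_card box_def in_set_conv_nth list_of_vec_index carrier_vecD)
    qed (use fin_T in auto)
    also have "\<dots> = (\<Sum>A\<in>T. \<Sum>x | x \<in> box n m \<and> P (list_of_vec x) \<and> set (list_of_vec x) = A. F A)"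
    proof (rule sum.cong[OF refl], rule sum.cong)
      fix A x assume "x \<in> {x \<in> box n m. P (list_of_vec x) \<and> set (list_of_vec x) = A}"
      then show "(V x)\<^sup>2 = F A" using V_square_eq_set[of x] P by (auto simp: F_def)
    qed auto
    also have "\<dots> = (\<Sum>A\<in>T. real (card {xs. set xs = A \<and> P xs}) * F A)"
      using card_box_lists[of _ P] P by (intro sum.cong refl) (simp add: T_def)
    finally show ?thesis .
  qed
  have fin_A: "finite A" "A \<noteq> {}" if "A \<in> T" for A
    using that finite_subset[of A] n_pos by (auto simp: T_def)
  have "(\<Sum>x\<in>alcove_box. (V x)\<^sup>2) = (\<Sum>A\<in>T. real n * F A)"
  proof -
    have "(\<Sum>x\<in>alcove_box. (V x)\<^sup>2) = (\<Sum>A\<in>T. real (card {xs. set xs = A \<and> decreasing_rotation xs}) * F A)"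
      by (rule by_support) (rule decreasing_rotation_distinct)
    also have "\<dots> = (\<Sum>A\<in>T. real n * F A)"
      by (intro sum.cong refl) (simp add: card_decreasing_rotations fin_A, simp add: T_def)
    finally show ?thesis .
  qed
  moreover have "(\<Sum>x\<in>box n m. (V x)\<^sup>2) = (\<Sum>A\<in>T. fact n * F A)"
  proof -
    have "(\<Sum>x\<in>box n m. (V x)\<^sup>2) = (\<Sum>x | x \<in> box n m \<and> distinct (list_of_vec x). (V x)\<^sup>2)"
    proof (rule sum.mono_neutral_right)
      show "\<forall>x\<in>box n m - {x. x \<in> box n m \<and> distinct (list_of_vec x)}. (V x)\<^sup>2 = 0"
        using V_zero[OF box_carrier] distinct_list_iff by auto
    qed auto
    also have "\<dots> = (\<Sum>A\<in>T. real (card {xs. set xs = A \<and> distinct xs}) * F A)"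
      by (rule by_support)
    also have "\<dots> = (\<Sum>A\<in>T. fact n * F A)"
      using card_permutations_of_set[OF fin_A(1)]
      by (intro sum.cong refl) (simp add: T_def permutations_of_set_def)
    finally show ?thesis .
  qed
  ultimately have "fact n * (2 ^ (n\<^sup>2 - n) * (\<Sum>x\<in>alcove_box. (V x)\<^sup>2)) =
      real n * (2 ^ (n\<^sup>2 - n) * (\<Sum>x\<in>box n m. (V x)\<^sup>2))"
    by (simp add: sum_distrib_left[symmetric])
  also have "\<dots> = fact n * (real n * real m ^ n)"
    unfolding V_square_sum_box by simp
  finally show ?thesis by simp
qed

end

subsection \<open>The asymptotics\<close>

context circle
begin

text \<open>With no steps left the walk is at a translate of \<open>l\<close>, whose total differs
  by a multiple of \<open>n * m\<close>; every step flips the parity.\<close>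

lemma walk_count_parity:
  assumes nm: "even (n * m)" and l: "l \<in> W"
  shows "p \<in> W \<Longrightarrow> walk_count l k p \<noteq> 0 \<Longrightarrow> even (vec_total p + int k + vec_total l)"
proof (induction k arbitrary: p)
  case 0
  then have "same_circle_point m p l"
    using walk_count_0[OF alcove_carrier[OF 0(1)], of l] by presburger
  then obtain N where N: "\<forall>i<n. p $ i = l $ i + N * int m"
    using alcove_same_shift[OF 0(1) l] by blast
  have "p = shift N l"
  proof (rule eq_vecI)
    fix i assume "i < dim_vec (shift N l)"
    then have "i < n" by (simp add: shift_def)
    then show "p $ i = shift N l $ i" using N by simp
  qed (use carrier_vecD[OF alcove_carrier[OF 0(1)]] in \<open>simp add: shift_def\<close>)
  then have "vec_total p = vec_total l + N * int (n * m)"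
    using vec_total_shift[OF alcove_carrier[OF l]] by simp
  then show ?case using nm by simp
next
  case (Suc k)
  then have "(\<Sum>e\<in>{e \<in> standard_steps n. p + e \<in> W}. walk_count l k (p + e)) \<noteq> 0"
    by (simp add: walk_count_step_sum)
  then obtain e where e: "e \<in> standard_steps n" "p + e \<in> W" "walk_count l k (p + e) \<noteq> 0"
    by (metis (mono_tags, lifting) mem_Collect_eq sum.neutral)
  have "even (vec_total (p + e) + int k + vec_total l)" using Suc.IH e by blast
  then show ?case
    using odd_vec_total_add_step[OF alcove_carrier[OF Suc.prems(1)] e(1)] by auto
qed

end

context circle_with_room
begin

text \<open>The lifts \<open>q x\<close> are chosen because \<open>ratio\<close> divides by
  \<open>V\<close>, which is positive on the alcove but may be negative at the box point.\<close>

lemma weighted_ratio_sum: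
  assumes l: "l \<in> W" and q: "\<And>x. x \<in> alcove_box \<Longrightarrow> q x \<in> W \<and> same_circle_point m (q x) x"
  shows "(\<Sum>x\<in>alcove_box. (V x)\<^sup>2 * ratio l k (q x)) = V l"
proof -
  have "\<rho> ^ k * V l = (\<Sum>x\<in>box n m. \<bar>V x\<bar> * walk_count l k x)"
    by (rule weighted_walk_count_sum[OF l, symmetric])
  also have "\<dots> = (\<Sum>x\<in>alcove_box. \<bar>V x\<bar> * walk_count l k x)"
  proof (rule sum.mono_neutral_right)
    show "\<forall>x\<in>box n m - alcove_box. \<bar>V x\<bar> * walk_count l k x = 0"
    proof
      fix x assume x: "x \<in> box n m - alcove_box"
      then have "walk_count l k x = 0"
        using walk_count_support[OF l box_carrier[of x n m]] box_alcove_iff[of x] by blast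
      then show "\<bar>V x\<bar> * walk_count l k x = 0" by simp
    qed
  qed auto
  also have "\<dots> = (\<Sum>x\<in>alcove_box. \<rho> ^ k * ((V x)\<^sup>2 * ratio l k (q x)))"
  proof (rule sum.cong[OF refl])
    fix x assume x: "x \<in> alcove_box"
    note qx = q[OF x]
    have qc: "q x \<in> carrier_vec n" using qx alcove_carrier by blast
    have "walk_count l k x = walk_count l k (q x)"
      using walk_count_same[OF qc conjunct2[OF qx]] by simp
    moreover have "\<bar>V x\<bar> = V (q x)" "V (q x) > 0"
      using abs_V_same[OF qc, of x] V_pos[of "q x"] qx by auto
    moreover from this have "(V x)\<^sup>2 = (V (q x))\<^sup>2" by (metis power2_abs)
    ultimately show "\<bar>V x\<bar> * walk_count l k x = \<rho> ^ k * ((V x)\<^sup>2 * ratio l k (q x))"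
      using \<rho>_pos by (simp add: ratio_def power2_eq_square)
  qed
  also have "\<dots> = \<rho> ^ k * (\<Sum>x\<in>alcove_box. (V x)\<^sup>2 * ratio l k (q x))"
    by (rule sum_distrib_left[symmetric])
  finally show ?thesis using \<rho>_pos by simp
qed

definition is_limit :: "int vec \<Rightarrow> int \<Rightarrow> real \<Rightarrow> bool" where
  "is_limit l c L \<longleftrightarrow> (\<forall>\<epsilon>>0. \<forall>\<^sub>F k in sequentially.
    \<forall>x\<in>{x \<in> W. even (vec_total x + int k + c)}. \<bar>ratio l k x - L\<bar> < \<epsilon>)"

text \<open>At two consecutive times a point belongs once to each parity class, so the two limits can be
  read off from the conserved weighted sum.\<close>

lemma limits_sum:
  assumes l: "l \<in> W" and L: "is_limit l c L" and L': "is_limit l (c + 1) L'"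
  shows "(L + L') * (real n * real m ^ n) = 2 * 2 ^ (n\<^sup>2 - n) * V l"
proof -
  have consecutive: "(\<lambda>k. ratio l k x + ratio l (Suc k) x) \<longlonglongrightarrow> L + L'" if x: "x \<in> W" for x
  proof (rule tendstoI)
    fix \<epsilon> :: real assume "\<epsilon> > 0"
    then have "\<epsilon> / 2 > 0" by simp
    define P where "P k \<longleftrightarrow> (\<forall>x\<in>{x \<in> W. even (vec_total x + int k + c)}. \<bar>ratio l k x - L\<bar> < \<epsilon> / 2) \<and>
      (\<forall>x\<in>{x \<in> W. even (vec_total x + int k + (c + 1))}. \<bar>ratio l k x - L'\<bar> < \<epsilon> / 2)" for k
    have "\<forall>\<^sub>F k in sequentially. P k"
      unfolding P_def using L L' \<open>\<epsilon> / 2 > 0\<close> unfolding is_limit_def by (intro eventually_conj) blast+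
    then have "\<forall>\<^sub>F k in sequentially. P k \<and> P (Suc k)"
      using eventually_conj eventually_sequentially_Suc by blast
    then show "\<forall>\<^sub>F k in sequentially. dist (ratio l k x + ratio l (Suc k) x) (L + L') < \<epsilon>"
    proof eventually_elim
      case (elim k)
      have "\<bar>ratio l k x - L\<bar> < \<epsilon> / 2 \<and> \<bar>ratio l (Suc k) x - L'\<bar> < \<epsilon> / 2 \<or>
          \<bar>ratio l k x - L'\<bar> < \<epsilon> / 2 \<and> \<bar>ratio l (Suc k) x - L\<bar> < \<epsilon> / 2"
        using elim x unfolding P_def by (cases "even (vec_total x + int k + c)") auto
      then show ?case unfolding dist_real_def by (elim disjE conjE) (simp_all add: abs_if split: if_splits)
    qed
  qed
  define q where "q x = (SOME y. y \<in> W \<and> same_circle_point m y x)" for x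
  have q: "q x \<in> W \<and> same_circle_point m (q x) x" if "x \<in> alcove_box" for x
    unfolding q_def by (rule someI_ex) (use that box_alcove_iff in blast)
  define Z where "Z = (\<Sum>x\<in>alcove_box. (V x)\<^sup>2)"
  have "(\<lambda>k. \<Sum>x\<in>alcove_box. (V x)\<^sup>2 * (ratio l k (q x) + ratio l (Suc k) (q x))) \<longlonglongrightarrow>
      (\<Sum>x\<in>alcove_box. (V x)\<^sup>2 * (L + L'))"
    using q by (intro tendsto_sum tendsto_mult tendsto_const consecutive) blast
  moreover have "(\<Sum>x\<in>alcove_box. (V x)\<^sup>2 * (ratio l k (q x) + ratio l (Suc k) (q x))) = 2 * V l" for k
    using weighted_ratio_sum[OF l q, of k] weighted_ratio_sum[OF l q, of "Suc k"]
    by (simp add: distrib_left sum.distrib)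
  ultimately have "(\<lambda>k::nat. 2 * V l) \<longlonglongrightarrow> Z * (L + L')"
    by (simp add: Z_def sum_distrib_right)
  then have "2 * V l = Z * (L + L')" by (simp add: LIMSEQ_const_iff)
  moreover have "2 ^ (n\<^sup>2 - n) * Z = real n * real m ^ n"
    unfolding Z_def by (rule V_square_sum)
  ultimately show ?thesis by (metis (no_types, opaque_lifting) mult.assoc mult.commute)
qed

lemma ratio_limit_even:
  assumes nm: "even (n * m)" and l: "l \<in> W"
  shows "is_limit l (vec_total l) (2 ^ (n\<^sup>2 - n + 1) / (real n * real m ^ n) * V l)"
proof -
  obtain L where L: "is_limit l (vec_total l) L"
    using ratio_converges unfolding is_limit_def by blast
  obtain L' where L': "is_limit l (vec_total l + 1) L'"
    using ratio_converges unfolding is_limit_def by blast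
  \<comment> \<open>At odd times \<open>l\<close> belongs to the class without walks, so its
    \<open>ratio\<close> is zero. Such times are arbitrarily large, and this single point determines
    the limit of its class.\<close>
  have "L' = 0"
  proof (rule ccontr)
    assume "L' \<noteq> 0"
    then have "\<forall>\<^sub>F k in sequentially. \<forall>x\<in>{x \<in> W. even (vec_total x + int k + (vec_total l + 1))}.
        \<bar>ratio l k x - L'\<bar> < \<bar>L'\<bar>"
      using L' unfolding is_limit_def by (meson zero_less_abs_iff)
    then obtain k0 where k0: "\<And>k x. k \<ge> k0 \<Longrightarrow> x \<in> W \<Longrightarrow> even (vec_total x + int k + (vec_total l + 1)) \<Longrightarrow>
        \<bar>ratio l k x - L'\<bar> < \<bar>L'\<bar>"
      unfolding eventually_sequentially by blast
    have "walk_count l (2 * k0 + 1) l = 0"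
      using walk_count_parity[OF nm l l, of "2 * k0 + 1"] by auto
    then have "ratio l (2 * k0 + 1) l = 0" by (simp add: ratio_def)
    then show False using k0[of "2 * k0 + 1" l] l by auto
  qed
  then have "L * (real n * real m ^ n) = 2 * 2 ^ (n\<^sup>2 - n) * V l"
    using limits_sum[OF l L L'] by simp
  then have "L = 2 ^ (n\<^sup>2 - n + 1) / (real n * real m ^ n) * V l"
    using n_pos m_pos by (simp add: field_simps)
  then show ?thesis using L by simp
qed

text \<open>Translation of all coordinates by \<open>m\<close> keeps \<open>ratio\<close> but moves
  a point into the other parity class, since \<open>n * m\<close> is odd. The two limits therefore
  agree, and each is half of their sum.\<close>

lemma ratio_limit_odd:
  assumes nm: "odd (n * m)" and l: "l \<in> W"
  shows "is_limit l c (2 ^ (n\<^sup>2 - n) / (real n * real m ^ n) * V l)"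
proof -
  obtain L where L: "is_limit l c L"
    using ratio_converges unfolding is_limit_def by blast
  obtain L' where L': "is_limit l (c + 1) L'"
    using ratio_converges unfolding is_limit_def by blast
  have "L = L'"
  proof (rule ccontr)
    assume "L \<noteq> L'"
    define \<epsilon> where "\<epsilon> = \<bar>L - L'\<bar> / 2"
    have "\<epsilon> > 0" using \<open>L \<noteq> L'\<close> by (simp add: \<epsilon>_def)
    then have "\<forall>\<^sub>F k in sequentially.
      (\<forall>x\<in>{x \<in> W. even (vec_total x + int k + c)}. \<bar>ratio l k x - L\<bar> < \<epsilon>) \<and>
      (\<forall>x\<in>{x \<in> W. even (vec_total x + int k + (c + 1))}. \<bar>ratio l k x - L'\<bar> < \<epsilon>)"
      using L L' unfolding is_limit_def by (intro eventually_conj) blast+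
    then obtain k where k:
      "\<And>x. x \<in> W \<Longrightarrow> even (vec_total x + int k + c) \<Longrightarrow> \<bar>ratio l k x - L\<bar> < \<epsilon>"
      "\<And>x. x \<in> W \<Longrightarrow> even (vec_total x + int k + (c + 1)) \<Longrightarrow> \<bar>ratio l k x - L'\<bar> < \<epsilon>"
      unfolding eventually_sequentially by blast
    define l' where "l' = shift 1 l"
    have l': "l' \<in> W" "ratio l k l' = ratio l k l"
      using shift_alcove[OF l] ratio_same[OF _ l] shift_same[OF alcove_carrier[OF l]]
      by (auto simp: l'_def)
    have "vec_total l' = vec_total l + int (n * m)"
      using vec_total_shift[OF alcove_carrier[OF l], of 1] by (simp add: l'_def)
    then have "even (vec_total l') \<longleftrightarrow> odd (vec_total l)" using nm by simp
    then have "\<bar>ratio l k l - L\<bar> < \<epsilon> \<and> \<bar>ratio l k l - L'\<bar> < \<epsilon>"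
      using k(1)[OF l] k(2)[OF l] k(1)[OF l'(1)] k(2)[OF l'(1)] l'(2) by auto
    then show False unfolding \<epsilon>_def by (auto simp: abs_if split: if_splits)
  qed
  then have "2 * (L * (real n * real m ^ n)) = 2 * (2 ^ (n\<^sup>2 - n) * V l)"
    using limits_sum[OF l L L'] by (simp add: distrib_right)
  then have "L = 2 ^ (n\<^sup>2 - n) / (real n * real m ^ n) * V l"
    using n_pos m_pos by (simp add: field_simps)
  then show ?thesis using L by simp
qed

lemma is_limit_tendsto:
  assumes x: "x \<in> W" and L: "is_limit l c L"
    and K: "\<And>k. k \<in> K \<Longrightarrow> even (vec_total x + int k + c)"
  shows "((\<lambda>k. ratio l k x) \<longlongrightarrow> L) (inf at_top (principal K))"
proof (rule tendstoI)
  fix \<epsilon> :: real assume "\<epsilon> > 0"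
  then have "\<forall>\<^sub>F k in sequentially. \<forall>x\<in>{x \<in> W. even (vec_total x + int k + c)}. \<bar>ratio l k x - L\<bar> < \<epsilon>"
    using L unfolding is_limit_def by blast
  then show "\<forall>\<^sub>F k in inf at_top (principal K). dist (ratio l k x) L < \<epsilon>"
    unfolding eventually_inf_principal
  proof eventually_elim
    case (elim k)
    then show ?case using K x unfolding dist_real_def by blast
  qed
qed

lemma asymp_equiv_of_limit:
  assumes l: "l \<in> W" and "C > 0"
    and lim: "((\<lambda>k. ratio l k x) \<longlongrightarrow> C * V l) F"
  shows "(\<lambda>k. walk_count l k x) \<sim>[F] (\<lambda>k. C * \<rho> ^ k * (V x * V l))"
proof (rule asymp_equivI')
  from lim have "((\<lambda>k. ratio l k x / (C * V l)) \<longlongrightarrow> C * V l / (C * V l)) F"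
    using \<open>C > 0\<close> V_pos[OF l] by (intro tendsto_divide tendsto_const) auto
  moreover have "ratio l k x / (C * V l) = walk_count l k x / (C * \<rho> ^ k * (V x * V l))" for k
    by (simp add: ratio_def mult_ac)
  ultimately show "((\<lambda>k. walk_count l k x / (C * \<rho> ^ k * (V x * V l))) \<longlongrightarrow> 1) F"
    using \<open>C > 0\<close> V_pos[OF l] by simp
qed

end

text \<open>For \<open>k > 0\<close> both sides are zero: \<open>\<rho>\<close> contains
  \<open>sin pi\<close>, so the weighted sum of walk counts vanishes, and its terms are nonnegative.
  Asymptotic equivalence counts the quotient of two zeros as \<open>1\<close>.\<close>

lemma (in circle) packed_asymp_equiv:
  assumes packed: "n = m" "m > 1" and l: "l \<in> W" and x: "x \<in> box n m" "x \<in> W"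
  shows "(\<lambda>k. walk_count l k x) \<sim>[inf at_top (principal K)] (\<lambda>k. C * \<rho> ^ k * c)"
proof (rule asymp_equiv_refl_ev)
  have \<rho>: "\<rho> = 0" using packed by (simp add: sine_quotient_def)
  have eq: "walk_count l k x = C * \<rho> ^ k * c" if "k > 0" for k
  proof -
    have "(\<Sum>x\<in>box n m. \<bar>V x\<bar> * walk_count l k x) = 0"
      unfolding weighted_walk_count_sum[OF l] \<rho> using that by simp
    then have "\<bar>V x\<bar> * walk_count l k x = 0"
      using x(1) by (subst (asm) sum_nonneg_eq_0_iff) (auto simp: walk_count_nonneg)
    then show ?thesis using V_pos[OF x(2)] that \<rho> by simp
  qed
  show "\<forall>\<^sub>F k in inf at_top (principal K). walk_count l k x = C * \<rho> ^ k * c"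
    unfolding eventually_inf_principal
    by (rule eventually_mono[OF eventually_gt_at_top[of 0]]) (simp add: eq)
qed

theorem theorem17:
  fixes n m s :: nat and \<eta> l :: "int vec"
  assumes "n \<ge> 1" and "m > 0"
    and "\<eta> \<in> carrier_vec n" and "l \<in> carrier_vec n"
    and "\<forall>i<n. 0 \<le> \<eta> $ i \<and> \<eta> $ i < int m"
    and "sorted_wrt (>) (list_of_vec \<eta>)"
    and "s \<le> n"
    and "\<forall>i<n. 0 \<le> l $ i \<and> l $ i < int m"
    and "sorted_wrt (>) (drop s (list_of_vec l) @ take s (list_of_vec l))"
  defines "K \<equiv> {k :: nat. \<exists>N :: int.
      [int k = vec_total l - vec_total \<eta> + N * int n * int m + int s * int m] (mod 2)}"
  shows
    "(even n \<or> (odd n \<and> even m) \<longrightarrow>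
        (\<lambda>k. real (card (noncolliding_circle_walks n m \<eta> l k)))
          \<sim>[inf at_top (principal K)]
        (\<lambda>k. 2 ^ (n\<^sup>2 - n + 1) / (real n * real m ^ n)
              * (2 * sine_quotient n m) ^ k * sine_product n m \<eta> l)) \<and>
     (odd n \<and> odd m \<longrightarrow>
        (\<lambda>k. real (card (noncolliding_circle_walks n m \<eta> l k)))
          \<sim>[inf at_top (principal K)]
        (\<lambda>k. 2 ^ (n\<^sup>2 - n) / (real n * real m ^ n)
              * (2 * sine_quotient n m) ^ k * sine_product n m \<eta> l))"
proof -
  have \<eta>_box: "\<eta> \<in> box n m" and l_box: "l \<in> box n m"
    using assms(3-5,8) by (auto simp: box_def)
  have "n \<le> m"
  proof -
    have "sorted_wrt (<) (rev (list_of_vec \<eta>))" using assms(6) by (simp add: sorted_wrt_rev)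
    then have "distinct (list_of_vec \<eta>)" by (simp add: strict_sorted_iff)
    then have "n = card (set (list_of_vec \<eta>))" using assms(3) by (simp add: distinct_card)
    also have "\<dots> \<le> card {0..<int m}"
      using assms(3,5) by (intro card_mono) (auto simp: in_set_conv_nth list_of_vec_index)
    finally show ?thesis by simp
  qed
  interpret circle n m by (rule circle.intro[OF assms(1) \<open>n \<le> m\<close>])
  \<comment> \<open>Passing to the alcove lift changes neither the walks nor
    \<open>\<bar>V\<bar>\<close>, but adds \<open>s * m\<close> to the total.\<close>
  define l' where "l' = lift s l"
  have l': "l' \<in> W" "same_circle_point m l' l"
    unfolding l'_def using lift_alcove[OF l_box assms(7,9)] lift_same[OF assms(4)] by auto
  have l'_total: "vec_total l' = vec_total l + int s * int m"
    unfolding l'_def by (rule vec_total_lift[OF assms(4,7)])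
  have \<eta>: "\<eta> \<in> W"
  proof -
    have "lift 0 \<eta> = \<eta>"
      by (rule eq_vecI) (use assms(3) in \<open>auto simp: lift_def\<close>)
    then show ?thesis using lift_alcove[OF \<eta>_box, of 0] assms(6) by simp
  qed
  have count: "real (card (noncolliding_circle_walks n m \<eta> l k)) = walk_count l' k \<eta>" for k
    using walk_count_target[OF l'(2)] by (simp add: walk_count_def)
  have product: "sine_product n m \<eta> l = V \<eta> * V l'"
    using abs_V_same[OF alcove_carrier[OF l'(1)] l'(2)] V_pos[OF l'(1)] by (simp add: sine_product_eq)
  show ?thesis
  proof (cases "n < m \<or> n = 1")
    case True
    then interpret circle_with_room n m
      by (intro circle_with_room.intro circle_with_room_axioms.intro circle_axioms)
    show ?thesis
      unfolding count product
    proof (intro conjI impI)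
      assume "even n \<or> odd n \<and> even m"
      then have nm: "even (n * m)" by auto
      show "(\<lambda>k. walk_count l' k \<eta>) \<sim>[inf at_top (principal K)]
          (\<lambda>k. 2 ^ (n\<^sup>2 - n + 1) / (real n * real m ^ n) * \<rho> ^ k * (V \<eta> * V l'))"
      proof (rule asymp_equiv_of_limit[OF l'(1) _ is_limit_tendsto[OF \<eta> ratio_limit_even[OF nm l'(1)]]])
        fix k assume "k \<in> K"
        then obtain N where N: "[int k = vec_total l - vec_total \<eta> + N * int n * int m + int s * int m] (mod 2)"
          by (auto simp: K_def)
        \<comment> \<open>As \<open>n * m\<close> is even, the multiple by \<open>N\<close> drops
          out, and \<open>s * m\<close> is absorbed into the total of the lift.\<close>
        then have "even (int k - (vec_total l - vec_total \<eta> + N * int (n * m) + int s * int m))"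
          by (simp add: cong_iff_dvd_diff mult.assoc)
        then show "even (vec_total \<eta> + int k + vec_total l')"
          using nm unfolding l'_total by auto
      qed (use n_pos m_pos in simp)
    next
      assume "odd n \<and> odd m"
      then have nm: "odd (n * m)" by simp
      show "(\<lambda>k. walk_count l' k \<eta>) \<sim>[inf at_top (principal K)]
          (\<lambda>k. 2 ^ (n\<^sup>2 - n) / (real n * real m ^ n) * \<rho> ^ k * (V \<eta> * V l'))"
      proof (rule asymp_equiv_of_limit[OF l'(1)])
        let ?L = "2 ^ (n\<^sup>2 - n) / (real n * real m ^ n) * V l'"
        let ?A = "{k. even (vec_total \<eta> + int k)}"
        \<comment> \<open>For odd \<open>n * m\<close> the set \<open>K\<close> contains every
          \<open>k\<close>, so the common limit along the even and the odd class is combined into a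
          limit along all \<open>k\<close>.\<close>
        have "((\<lambda>k. ratio l' k \<eta>) \<longlongrightarrow> ?L) (inf at_top (principal ?A))"
          by (rule is_limit_tendsto[OF \<eta> ratio_limit_odd[OF nm l'(1), of 0]]) simp
        moreover have "((\<lambda>k. ratio l' k \<eta>) \<longlongrightarrow> ?L) (inf at_top (principal (- ?A)))"
          by (rule is_limit_tendsto[OF \<eta> ratio_limit_odd[OF nm l'(1), of 1]]) simp
        ultimately have "((\<lambda>k. ratio l' k \<eta>) \<longlongrightarrow> ?L) at_top"
        proof (intro topological_tendstoI)
          fix S assume "open S" "?L \<in> S"
          assume "((\<lambda>k. ratio l' k \<eta>) \<longlongrightarrow> ?L) (inf at_top (principal ?A))"
            "((\<lambda>k. ratio l' k \<eta>) \<longlongrightarrow> ?L) (inf at_top (principal (- ?A)))"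
          note this[THEN topological_tendstoD, OF \<open>open S\<close> \<open>?L \<in> S\<close>, unfolded eventually_inf_principal]
          then show "\<forall>\<^sub>F k in at_top. ratio l' k \<eta> \<in> S"
            by (rule eventually_elim2) blast
        qed
        then show "((\<lambda>k. ratio l' k \<eta>) \<longlongrightarrow> ?L) (inf at_top (principal K))"
          by (rule tendsto_mono[rotated]) simp
      qed (use n_pos m_pos in simp)
    qed
  next
    case False
    then have "n = m" "m > 1" using \<open>n \<le> m\<close> n_pos by auto
    then show ?thesis
      unfolding count product using packed_asymp_equiv[OF _ _ l'(1) \<eta>_box \<eta>] by blast
  qed
qed

end
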